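(* Let $S:\mathbb{R}^n\rightrightarrows\mathbb{R}^m$ be a set-valued mapping, let $\bar{x}\in X\subset\mathbb{R}^n$ where $X$ is a closed set that is a smooth manifold around $\bar{x}$, and let $\bar{u}\in S(\bar{x})$. Suppose that $\operatorname{gph}S$ is locally closed at $(\bar{x},\bar{u})$. Then the following properties are equivalent: (a) $S$ has the Lipschitz-like property relative to $X$ at $\bar{x}$ for $\bar{u}$. (b) $\operatorname{proj}_{T_X(\bar{x})}D^*S|_X(\bar{x}\mid\bar{u})(0)=\{0\}$. (c) $\left|\operatorname{proj}_{T_X(\bar{x})}D^*S|_X(\bar{x}\mid\bar{u})\right|^+<+\infty$. (d) $D^*S|_X(\bar{x}\mid\bar{u})(0)\cap T_X(\bar{x})=\{0\}$. (e) $D^*S|_X(\bar{x}\mid\bar{u})(0)=N_X(\bar{x})$. (f) $D^*_XS(\bar{x}\mid\bar{u})(0)=\{0\}$. Furthermore, $$\operatorname{lip}_XS(\bar{x}\mid\bar{u})=\left|\operatorname{proj}_{T_X(\bar{x})}D^*S|_X(\bar{x}\mid\bar{u})\right|^+.$$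
   Context: For $C\subseteq\mathbb{R}^n$ and $x\in C$: $T_C(x)=\limsup_{t\searrow 0}\frac{C-x}{t}$ (outer limit) is the tangent (contingent) cone; the regular normal cone is $\widehat{N}_C(x)=\{v\mid \limsup_{x'\to x,\,x'\in C,\,x'\neq x}\langle v,x'-x\rangle/\|x'-x\|\le 0\}$; the limiting normal cone $N_C(x)$ is the set of $v$ for which there are $x_k\to x$, $x_k\in C$, and $v_k\to v$ with $v_k\in\widehat{N}_C(x_k)$. These are empty for $x\notin C$. $C$ is locally closed at $x\in C$ if $C\cap U$ is closed for some closed neighborhood $U$ of $x$. $\mathbb{B}$ is the closed unit ball. $\operatorname{proj}_C(x)=\{y\in C\mid\|y-x\|=d(x,C)\}$ and $\operatorname{proj}_CA=\bigcup_{a\in A}\operatorname{proj}_C(a)$; for a mapping $H$, $\operatorname{proj}_CH$ is the mapping $u^*\mapsto\operatorname{proj}_C(H(u^* ))$. For a positively homogeneous mapping $H$ (one whose graph is a cone) the outer norm is $|H|^+=\sup_{u\in\mathbb{B}}\sup_{v\in H(u)}\|v\|\in[0,+\infty]$. For $S:\mathbb{R}^n\rightrightarrows\mathbb{R}^m$, $\operatorname{gph}S=\{(x,u)\mid u\in S(x)\}$; $S|_X$ equals $S(x)$ for $x\in X$ and $\emptyset$ for $x\notin X$. The coderivative is defined by $x^*\in D^*S(\bar{x}\mid\bar{u})(u^* )\iff(x^*,-u^* )\in N_{\operatorname{gph}S}(\bar{x},\bar{u})$. The projectional coderivative $D^*_XS(\bar{x}\mid\bar{u}):\mathbb{R}^m\rightrightarrows\mathbb{R}^n$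 (for $\bar{x}\in X$, $\bar{u}\in S(\bar{x})$) is defined by $$t^*\in D^*_XS(\bar{x}\mid\bar{u})(u^* )\iff(t^*,-u^* )\in\limsup_{(x,u)\to(\bar{x},\bar{u}),\,(x,u)\in\operatorname{gph}S|_X}\operatorname{proj}_{T_X(x)\times\mathbb{R}^m}N_{\operatorname{gph}S|_X}(x,u),$$ with $\limsup$ the (Painlevé–Kuratowski) outer limit of sets. $S$ has the Lipschitz-like property relative to $X$ at $\bar{x}\in X$ for $\bar{u}\in S(\bar{x})$ if $\operatorname{gph}S$ is locally closed at $(\bar{x},\bar{u})$ and there are neighborhoods $V$ of $\bar{x}$, $W$ of $\bar{u}$ and a constant $\kappa\ge0$ such that $$S(x')\cap W\subset S(x)+\kappa\|x'-x\|\mathbb{B}\qquad\forall x,x'\in X\cap V.$$ The graphical modulus $\operatorname{lip}_XS(\bar{x}\mid\bar{u})$ is the infimum of all $\kappa\ge0$ for which there are neighborhoods $V$ of $\bar{x}$ and $W$ of $\bar{u}$ such that this inclusion holds for all $x,x'\in X\cap V$ (with $\inf\emptyset=+\infty$). $X$ is a ($d$-dimensional) smooth manifold around $\bar{x}\in X$ if there are an open neighborhood $O$ of $\bar{x}$ and a $\mathcal{C}^1$ mapping $F:O\to\mathbb{R}^{n-d}$ with $\nabla F(\bar{x})$ of full rank $n-d$ such that $X\cap O=\{x\in O\mid F(x)=0\}$. *)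

theory Defs
  imports "HOL-Analysis.Analysis"
begin

text \<open>Painleve-Kuratowski outer limit of the sets \<open>A i\<close> as \<open>i\<close> tends along the filter \<open>F\<close>.\<close>

definition outer_limit :: "'i filter \<Rightarrow> ('i \<Rightarrow> 'a::topological_space set) \<Rightarrow> 'a set" where
  "outer_limit F A =
     {y. \<exists>i z. filterlim i F sequentially \<and> (\<forall>k::nat. z k \<in> A (i k)) \<and> z \<longlonglongrightarrow> y}"

definition tangent_cone :: "'a::euclidean_space set \<Rightarrow> 'a \<Rightarrow> 'a set" where
  "tangent_cone C x =
     (if x \<in> C then outer_limit (at_right (0::real)) (\<lambda>t. {(c - x) /\<^sub>R t | c. c \<in> C}) else {})"

text \<open>At an isolated point of \<open>C\<close> the filter is \<open>bot\<close> and the upper limit is \<open>-\<infinity>\<close>,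
  so every vector is a regular normal.\<close>

definition regular_normal_cone :: "'a::euclidean_space set \<Rightarrow> 'a \<Rightarrow> 'a set" where
  "regular_normal_cone C x =
     (if x \<in> C
      then {v. Limsup (at x within C) (\<lambda>x'. ereal (v \<bullet> (x' - x) / norm (x' - x))) \<le> 0}
      else {})"

definition normal_cone :: "'a::euclidean_space set \<Rightarrow> 'a \<Rightarrow> 'a set" where
  "normal_cone C x =
     (if x \<in> C
      then {v. \<exists>y w. y \<longlonglongrightarrow> x \<and> (\<forall>k::nat. y k \<in> C) \<and> w \<longlonglongrightarrow> v
                 \<and> (\<forall>k. w k \<in> regular_normal_cone C (y k))}
      else {})"

definition locally_closed_at :: "'a::topological_space set \<Rightarrow> 'a \<Rightarrow> bool" where
  "locally_closed_at C x \<longleftrightarrow>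
     x \<in> C \<and> (\<exists>U. closed U \<and> x \<in> interior U \<and> closed (C \<inter> U))"

definition proj_point :: "'a::euclidean_space set \<Rightarrow> 'a \<Rightarrow> 'a set" where
  "proj_point C x = {y \<in> C. norm (y - x) = infdist x C}"

definition proj_set :: "'a::euclidean_space set \<Rightarrow> 'a set \<Rightarrow> 'a set" where
  "proj_set C A = (\<Union>a\<in>A. proj_point C a)"

definition proj_map :: "'a::euclidean_space set \<Rightarrow> ('b \<Rightarrow> 'a set) \<Rightarrow> 'b \<Rightarrow> 'a set" where
  "proj_map C H = (\<lambda>u. proj_set C (H u))"

text \<open>Values lie in \<open>[0, \<infinity>]\<close>; suprema of empty sets are \<open>0\<close>, which is harmless since
  \<open>0 \<in> H 0\<close> for the mappings of interest.\<close>

definition outer_norm :: "('a::real_normed_vector \<Rightarrow> 'b::real_normed_vector set) \<Rightarrow> ennreal" where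
  "outer_norm H = (SUP u\<in>cball 0 1. SUP v\<in>H u. ennreal (norm v))"

definition gph :: "('a \<Rightarrow> 'b set) \<Rightarrow> ('a \<times> 'b) set" where
  "gph S = {(x, u). u \<in> S x}"

definition restr :: "('a \<Rightarrow> 'b set) \<Rightarrow> 'a set \<Rightarrow> 'a \<Rightarrow> 'b set" where
  "restr S X = (\<lambda>x. if x \<in> X then S x else {})"

definition coderivative ::
    "('a::euclidean_space \<Rightarrow> 'b::euclidean_space set) \<Rightarrow> 'a \<Rightarrow> 'b \<Rightarrow> 'b \<Rightarrow> 'a set" where
  "coderivative S x u = (\<lambda>u'. {x'. (x', - u') \<in> normal_cone (gph S) (x, u)})"

text \<open>The outer limit is taken over all points of the graph near \<open>(x, u)\<close>, the point
  \<open>(x, u)\<close> itself included.\<close>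

definition proj_coderivative ::
    "'a::euclidean_space set \<Rightarrow> ('a \<Rightarrow> 'b::euclidean_space set) \<Rightarrow> 'a \<Rightarrow> 'b \<Rightarrow> 'b \<Rightarrow> 'a set" where
  "proj_coderivative X S x u = (\<lambda>u'. {t'. (t', - u') \<in>
     outer_limit (inf (nhds (x, u)) (principal (gph (restr S X))))
       (\<lambda>p. proj_set (tangent_cone X (fst p) \<times> UNIV) (normal_cone (gph (restr S X)) p))})"

definition lipschitz_inclusion ::
    "'a::euclidean_space set \<Rightarrow> ('a \<Rightarrow> 'b::euclidean_space set) \<Rightarrow> 'a set \<Rightarrow> 'b set \<Rightarrow> real \<Rightarrow> bool"
  where
  "lipschitz_inclusion X S V W \<kappa> \<longleftrightarrow>
     (\<forall>x\<in>X \<inter> V. \<forall>x'\<in>X \<inter> V.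
        S x' \<inter> W \<subseteq> {s + (\<kappa> * norm (x' - x)) *\<^sub>R b | s b. s \<in> S x \<and> b \<in> cball 0 1})"

definition lipschitz_like ::
    "'a::euclidean_space set \<Rightarrow> ('a \<Rightarrow> 'b::euclidean_space set) \<Rightarrow> 'a \<Rightarrow> 'b \<Rightarrow> bool" where
  "lipschitz_like X S xb ub \<longleftrightarrow>
     locally_closed_at (gph S) (xb, ub) \<and>
     (\<exists>V W \<kappa>. xb \<in> interior V \<and> ub \<in> interior W \<and> 0 \<le> \<kappa> \<and> lipschitz_inclusion X S V W \<kappa>)"

definition lip_modulus ::
    "'a::euclidean_space set \<Rightarrow> ('a \<Rightarrow> 'b::euclidean_space set) \<Rightarrow> 'a \<Rightarrow> 'b \<Rightarrow> ennreal" where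
  "lip_modulus X S xb ub =
     Inf {ennreal \<kappa> | \<kappa>. 0 \<le> \<kappa> \<and>
       (\<exists>V W. xb \<in> interior V \<and> ub \<in> interior W \<and> lipschitz_inclusion X S V W \<kappa>)}"

text \<open>A map into the space of dimension \<open>DIM('a) - d\<close> is given by its component functions
  \<open>F i\<close>, \<open>i < DIM('a) - d\<close>; the gradients \<open>G i x\<close> are the rows of its Jacobian,
  and the last conjunct says that the Jacobian at \<open>xb\<close> has rank \<open>DIM('a) - d\<close>.\<close>

definition smooth_manifold_around :: "nat \<Rightarrow> 'a::euclidean_space set \<Rightarrow> 'a \<Rightarrow> bool" where
  "smooth_manifold_around d X xb \<longleftrightarrow>
     xb \<in> X \<and> d \<le> DIM('a) \<and>
     (\<exists>N (F :: nat \<Rightarrow> 'a \<Rightarrow> real) (G :: nat \<Rightarrow> 'a \<Rightarrow> 'a).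
        open N \<and> xb \<in> N \<and>
        (\<forall>i < DIM('a) - d. (\<forall>x\<in>N. GDERIV (F i) x :> G i x) \<and> continuous_on N (G i)) \<and>
        X \<inter> N = {x \<in> N. \<forall>i < DIM('a) - d. F i x = 0} \<and>
        dim ((\<lambda>i. G i xb) ` {..<DIM('a) - d}) = DIM('a) - d)"

end

theory Submission
  imports Defs
begin

text \<open>Near \<open>xb\<close> the set \<open>X\<close> has tangent spaces \<open>T(x)\<close>, the kernels of the constraint gradients, and
the whole argument runs through the orthogonal projections \<open>P(x)\<close> onto them. Two facts about
\<open>X\<close> carry it: \<open>P(x)\<close> depends continuously on \<open>x\<close>, and chords of \<open>X\<close> are almost tangent, that is,
the part of \<open>z - y\<close> orthogonal to \<open>T(y)\<close> is small compared with \<open>z - y\<close>. They are collected in the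
locale \<open>c1_tangent_spaces\<close>, and \<open>smooth_manifold_c1_tangent_spaces\<close> derives them from the
gradients. That every vector of the kernel is a tangent direction is the existence part of the
implicit function theorem; it is obtained from the error bound \<open>level_set_error_bound\<close>.

Let \<open>C\<close> be the graph of \<open>S\<close> restricted to \<open>X\<close>. It lies over \<open>X\<close>, so a normal of \<open>X\<close> paired with \<open>0\<close>
is a normal of \<open>C\<close>, and replacing a normal \<open>(v, w)\<close> of \<open>C\<close> by \<open>(P v, w)\<close> gives a normal again
(\<open>projected_normal\<close>). Hence projecting the coderivative onto \<open>T(xb)\<close> amounts to intersecting it
with \<open>T(xb)\<close>, and the projectional coderivative is the same set, because normals and tangent
spaces both pass to the limit. This makes (b), (d), (e) and (f) one condition; it is equivalent
to (c) by positive homogeneity and compactness of the unit sphere.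

The link with (a), and the formula for the modulus, is an estimate in each direction. If the
Lipschitz inclusion holds with constant \<open>\<kappa>\<close>, moving in \<open>X\<close> along the tangent direction \<open>P v\<close>
and following the inclusion in the graph shows \<open>|P v| \<le> \<kappa> |w|\<close> for every regular normal
\<open>(v, w)\<close> near the reference point, hence for limiting normals there. Conversely let \<open>\<kappa>\<^sub>1\<close> exceed
the outer norm and \<open>\<kappa>\<^sub>1 < \<kappa>' < \<kappa>\<close>. By compactness \<open>|P v| \<le> \<kappa>\<^sub>1 |w|\<close> for all regular normals at
nearby points. For \<open>x\<^sub>0, x\<^sub>1\<close> in \<open>X\<close> and \<open>u\<^sub>0 \<in> S x\<^sub>0\<close>, minimise \<open>|x - x\<^sub>1| + |(u - u\<^sub>0, \<epsilon>)| / \<kappa>'\<close> over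
the points \<open>(x, u)\<close> of \<open>C\<close> near the reference point. A minimiser with \<open>x \<noteq> x\<^sub>1\<close> would produce a
regular normal whose first component is the unit vector towards \<open>x\<^sub>1\<close>, with projection of norm
almost \<open>1\<close> since chords are almost tangent, and whose second component has norm at most \<open>1 / \<kappa>'\<close>;
the bound with \<open>\<kappa>\<^sub>1 < \<kappa>'\<close> forbids this. So the minimiser is \<open>(x\<^sub>1, u)\<close>, and comparing its value with
the value at \<open>(x\<^sub>0, u\<^sub>0)\<close> gives \<open>|u - u\<^sub>0| \<le> \<kappa> |x\<^sub>0 - x\<^sub>1|\<close>.\<close>

section \<open>Orthogonal projection onto subspaces\<close>

text \<open>Pythagoras: if \<open>v - p\<close> is orthogonal to \<open>K\<close>, then \<open>|v - z|\<^sup>2 = |v - p|\<^sup>2 + |p -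
z|\<^sup>2\<close> for \<open>z\<close> in \<open>K\<close>.\<close>

lemma closest_point_eq_of_orthogonal:
  fixes K :: "'a::euclidean_space set"
  assumes K: "subspace K" and p: "p \<in> K" and orth: "\<And>t. t \<in> K \<Longrightarrow> (v - p) \<bullet> t = 0"
  shows "closest_point K v = p"
proof -
  have "dist v p \<le> dist v z" if "z \<in> K" for z
  proof -
    have "(v - p) \<bullet> (p - z) = 0"
      using orth K p that by (simp add: subspace_diff)
    then have "(norm (v - z))\<^sup>2 = (norm (v - p))\<^sup>2 + (norm (p - z))\<^sup>2"
      using norm_add_Pythagorean[of "v - p" "p - z"] by (simp add: orthogonal_def)
    then show ?thesis
      unfolding dist_norm by - (rule power2_le_imp_le, simp_all)
  qed
  then show ?thesis
    using closest_point_unique[OF subspace_imp_convex[OF K] closed_subspace[OF K] p, of v] by simp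
qed

lemma closest_point_subspace:
  fixes K :: "'a::euclidean_space set"
  assumes K: "subspace K"
  shows closest_point_mem: "closest_point K v \<in> K"
    and closest_point_residual: "t \<in> K \<Longrightarrow> (v - closest_point K v) \<bullet> t = 0"
proof -
  obtain y z where yz: "y \<in> span K" "\<And>w. w \<in> span K \<Longrightarrow> orthogonal z w" "v = y + z"
    using orthogonal_subspace_decomp_exists[of K v] by blast
  have sp: "span K = K" using K by (simp only: span_eq_iff)
  have z: "z \<bullet> t = 0" if "t \<in> K" for t
    using yz(1,2) that unfolding sp orthogonal_def by blast
  have vy: "v - y = z" using yz(3) by simp
  have "closest_point K v = y"
  proof (rule closest_point_eq_of_orthogonal[OF K])
    show "y \<in> K" using yz(1) unfolding sp .
  qed (use z vy in simp)
  with yz(1) vy show "closest_point K v \<in> K" "t \<in> K \<Longrightarrow> (v - closest_point K v) \<bullet> t = 0"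
    using z unfolding sp by simp_all
qed

lemma closest_point_split:
  fixes K :: "'a::euclidean_space set"
  assumes K: "subspace K"
  shows "(norm v)\<^sup>2 = (norm (v - closest_point K v))\<^sup>2 + (norm (closest_point K v))\<^sup>2"
  using norm_add_Pythagorean[of "v - closest_point K v" "closest_point K v"]
    closest_point_residual[OF K closest_point_mem[OF K], of v v] by (simp add: orthogonal_def)

lemma norm_closest_point_le:
  fixes K :: "'a::euclidean_space set"
  assumes K: "subspace K"
  shows "norm (closest_point K v) \<le> norm v" "norm (v - closest_point K v) \<le> norm v"
  using closest_point_split[OF K, of v] by (auto intro: power2_le_imp_le[of _ "norm v"])

lemma closest_point_inner_self:
  fixes K :: "'a::euclidean_space set"
  assumes K: "subspace K"
  shows "v \<bullet> closest_point K v = (norm (closest_point K v))\<^sup>2"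
proof -
  have "(v - closest_point K v) \<bullet> closest_point K v = 0"
    by (intro closest_point_residual closest_point_mem K)
  then show ?thesis
    by (simp add: inner_diff_left power2_norm_eq_inner)
qed

lemma closest_point_scaleR:
  fixes K :: "'a::euclidean_space set"
  assumes K: "subspace K"
  shows "closest_point K (c *\<^sub>R v) = c *\<^sub>R closest_point K v"
proof (rule closest_point_eq_of_orthogonal[OF K])
  show "c *\<^sub>R closest_point K v \<in> K"
    by (intro subspace_scale closest_point_mem K)
  show "(c *\<^sub>R v - c *\<^sub>R closest_point K v) \<bullet> t = 0" if "t \<in> K" for t
    using closest_point_subspace(2)[OF K that, of v]
    by (simp flip: scaleR_diff_right)
qed

text \<open>A subspace is closed and convex, so the set-valued projection of the problem is single-valued.\<close>

lemma proj_point_subspace: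
  fixes K :: "'a::euclidean_space set"
  assumes K: "subspace K"
  shows "proj_point K v = {closest_point K v}"
proof -
  have cl: "closed K" and ne: "K \<noteq> {}" and cv: "convex K"
    using K by (auto simp: closed_subspace subspace_imp_convex dest: subspace_0)
  have in_le: "infdist v K \<le> dist v z" if "z \<in> K" for z
    using that by (rule infdist_le)
  obtain m where m: "m \<in> K" "infdist v K = dist v m"
    using infdist_attains_inf[OF cl ne] by blast
  have "dist v m = dist v (closest_point K v)"
    using closest_point_le[OF cl m(1), of v] in_le[OF closest_point_mem[OF K, of v]] m by simp
  then have inf: "infdist v K = norm (closest_point K v - v)"
    using m(2) by (simp add: dist_norm norm_minus_commute)
  have uniq: "y = closest_point K v" if "y \<in> K" "norm (y - v) = infdist v K" for y
  proof (rule closest_point_unique[OF cv cl that(1)])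
    show "\<forall>z\<in>K. dist v y \<le> dist v z"
      using in_le that(2) by (simp add: dist_norm norm_minus_commute)
  qed
  show ?thesis
  proof (intro equalityI subsetI)
    fix y assume "y \<in> proj_point K v"
    then show "y \<in> {closest_point K v}" using uniq unfolding proj_point_def by blast
  next
    fix y assume "y \<in> {closest_point K v}"
    then show "y \<in> proj_point K v"
      using closest_point_mem[OF K, of v] inf by (simp add: proj_point_def)
  qed
qed

lemma closest_point_Times_UNIV:
  fixes K :: "'a::euclidean_space set" and b :: "'b::euclidean_space"
  assumes K: "subspace K"
  shows "closest_point (K \<times> UNIV) (a, b) = (closest_point K a, b)"
proof (rule closest_point_eq_of_orthogonal)
  show "subspace (K \<times> (UNIV :: 'b set))"
    by (intro subspace_Times K subspace_UNIV)
  show "(closest_point K a, b) \<in> K \<times> UNIV"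
    using closest_point_mem[OF K] by simp
  fix t :: "'a \<times> 'b" assume "t \<in> K \<times> UNIV"
  then have "(a - closest_point K a) \<bullet> fst t = 0"
    by (auto intro: closest_point_residual K)
  then show "((a, b) - (closest_point K a, b)) \<bullet> t = 0"
    by (simp add: inner_prod_def)
qed

section \<open>Normal and tangent cones\<close>

text \<open>The form in which regular normals are used: an upper limit \<open>\<le> 0\<close> of difference quotients, with the denominators
cleared. At an isolated point both sides hold for every vector.\<close>

lemma regular_normal_cone_iff:
  "v \<in> regular_normal_cone C x \<longleftrightarrow>
     x \<in> C \<and> (\<forall>e>0. \<forall>\<^sub>F y in at x within C. v \<bullet> (y - x) \<le> e * norm (y - x))"
proof -
  have ne: "\<forall>\<^sub>F y in at x within C. y \<noteq> x"
    by (simp add: eventually_at_filter)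
  have "(\<forall>y>0. \<forall>\<^sub>F x' in at x within C. ereal (v \<bullet> (x' - x) / norm (x' - x)) < y) \<longleftrightarrow>
        (\<forall>e>0. \<forall>\<^sub>F y in at x within C. v \<bullet> (y - x) \<le> e * norm (y - x))" (is "?L \<longleftrightarrow> ?R")
  proof
    assume L: ?L
    show ?R
    proof (intro allI impI)
      fix e :: real assume "e > 0"
      then have "\<forall>\<^sub>F x' in at x within C. ereal (v \<bullet> (x' - x) / norm (x' - x)) < ereal e"
        using L by (metis ereal_less(2))
      then show "\<forall>\<^sub>F y in at x within C. v \<bullet> (y - x) \<le> e * norm (y - x)"
        using ne by eventually_elim (simp add: divide_simps)
    qed
  next
    assume R: ?R
    show ?L
    proof (intro allI impI)
      fix y :: ereal assume "y > 0"
      then obtain e where e: "0 < e" "ereal e < y"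
        by (metis ereal_dense2 ereal_less(2))
      then have "\<forall>\<^sub>F y in at x within C. v \<bullet> (y - x) \<le> e * norm (y - x)"
        using R by blast
      then show "\<forall>\<^sub>F x' in at x within C. ereal (v \<bullet> (x' - x) / norm (x' - x)) < y"
        using ne
      proof eventually_elim
        case (elim z)
        then have "ereal (v \<bullet> (z - x) / norm (z - x)) \<le> ereal e"
          by (simp add: divide_simps)
        then show ?case using e(2) by (rule le_less_trans)
      qed
    qed
  qed
  then show ?thesis
    unfolding regular_normal_cone_def by (simp add: Limsup_le_iff)
qed

lemma regular_normal_cone_add:
  assumes "v \<in> regular_normal_cone C x" "w \<in> regular_normal_cone C x"
  shows "v + w \<in> regular_normal_cone C x"
  unfolding regular_normal_cone_iff
proof (intro conjI allI impI)
  fix e :: real assume "e > 0"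
  then have "\<forall>\<^sub>F y in at x within C. v \<bullet> (y - x) \<le> e/2 * norm (y - x)"
    "\<forall>\<^sub>F y in at x within C. w \<bullet> (y - x) \<le> e/2 * norm (y - x)"
    using assms unfolding regular_normal_cone_iff by (meson half_gt_zero)+
  then show "\<forall>\<^sub>F y in at x within C. (v + w) \<bullet> (y - x) \<le> e * norm (y - x)"
    by eventually_elim (simp add: inner_add_left)
qed (use assms in \<open>simp add: regular_normal_cone_iff\<close>)

lemma regular_normal_cone_scaleR:
  assumes "v \<in> regular_normal_cone C x" "0 \<le> c"
  shows "c *\<^sub>R v \<in> regular_normal_cone C x"
proof (cases "c = 0")
  case True
  then show ?thesis using assms by (auto simp: regular_normal_cone_iff)
next
  case False
  then have c: "c > 0" using assms by simp
  show ?thesis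
    unfolding regular_normal_cone_iff
  proof (intro conjI allI impI)
    fix e :: real assume "e > 0"
    then have "\<forall>\<^sub>F y in at x within C. v \<bullet> (y - x) \<le> e/c * norm (y - x)"
      using assms(1) c unfolding regular_normal_cone_iff by (meson divide_pos_pos)
    then show "\<forall>\<^sub>F y in at x within C. (c *\<^sub>R v) \<bullet> (y - x) \<le> e * norm (y - x)"
      by eventually_elim (use c in \<open>simp add: field_simps\<close>)
  qed (use assms in \<open>simp add: regular_normal_cone_iff\<close>)
qed

text \<open>Normals of \<open>X\<close> lift to any set lying over \<open>X\<close>: the inner product sees only the first component of
\<open>q - p\<close>, whose norm is at most that of \<open>q - p\<close>.\<close>

lemma regular_normal_cone_fst:
  assumes "v \<in> regular_normal_cone X (fst p)" "p \<in> C" "fst ` C \<subseteq> X"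
  shows "(v, 0) \<in> regular_normal_cone C p"
  unfolding regular_normal_cone_iff
proof (intro conjI allI impI)
  fix e :: real assume e: "e > 0"
  then have "\<forall>\<^sub>F y in at (fst p) within X. v \<bullet> (y - fst p) \<le> e * norm (y - fst p)"
    using assms(1) by (simp add: regular_normal_cone_iff)
  then obtain d where d: "d > 0" "\<And>y. y \<in> X \<Longrightarrow> y \<noteq> fst p \<Longrightarrow> dist y (fst p) < d \<Longrightarrow>
      v \<bullet> (y - fst p) \<le> e * norm (y - fst p)"
    unfolding eventually_at by blast
  show "\<forall>\<^sub>F q in at p within C. (v, 0) \<bullet> (q - p) \<le> e * norm (q - p)"
    unfolding eventually_at
  proof (intro exI conjI ballI impI)
    fix q assume q: "q \<in> C" "q \<noteq> p \<and> dist q p < d"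
    have "v \<bullet> (fst q - fst p) \<le> e * norm (fst q - fst p)"
    proof (cases "fst q = fst p")
      case False
      moreover have "dist (fst q) (fst p) < d" using q dist_fst_le le_less_trans by blast
      ultimately show ?thesis using d(2) q assms(3) by blast
    qed simp
    also have "\<dots> \<le> e * norm (q - p)"
      using e norm_fst_le[of "fst (q - p)" "snd (q - p)"]
      by (metis fst_diff less_imp_le mult_left_mono prod.collapse)
    finally show "(v, 0) \<bullet> (q - p) \<le> e * norm (q - p)"
      by (simp add: inner_prod_def)
  qed fact
qed fact

text \<open>Fermat rule: at a minimum on \<open>C\<close> the first-order change \<open>g \<bullet> (y - z)\<close> can be negative only to
order \<open>o(|y - z|)\<close>.\<close>

lemma regular_normal_cone_of_minimum:
  assumes z: "z \<in> C" and der: "(f has_derivative (\<lambda>h. h \<bullet> g)) (at z within C)"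
    and min: "\<forall>\<^sub>F y in at z within C. f z \<le> f y"
  shows "- g \<in> regular_normal_cone C z"
  unfolding regular_normal_cone_iff
proof (intro conjI allI impI)
  fix e :: real assume e: "e > 0"
  obtain d where d: "d > 0"
    "\<And>y. y \<in> C \<Longrightarrow> norm (y - z) < d \<Longrightarrow> norm (f y - f z - (y - z) \<bullet> g) \<le> e * norm (y - z)"
    using der e unfolding has_derivative_within_alt by blast
  have "\<forall>\<^sub>F y in at z within C. y \<in> C \<and> norm (y - z) < d"
    unfolding eventually_at using d(1) by (auto simp: dist_norm)
  then show "\<forall>\<^sub>F y in at z within C. (- g) \<bullet> (y - z) \<le> e * norm (y - z)"
    using min
  proof eventually_elim
    case (elim y)
    then have "norm (f y - f z - (y - z) \<bullet> g) \<le> e * norm (y - z)" using d by blast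
    then show ?case using elim by (simp add: inner_commute abs_le_iff)
  qed
qed fact

text \<open>Compare with a small step in the direction \<open>- g\<close>, along which \<open>f\<close> decreases at rate \<open>|g|\<close>
while the penalty grows at rate \<open>\<delta>\<close>.\<close>

lemma norm_gradient_le_of_perturbed_minimum:
  assumes der: "GDERIV f z :> g" and min: "\<forall>\<^sub>F y in at z. f z \<le> f y + \<delta> * norm (y - z)"
    and "0 \<le> \<delta>"
  shows "norm g \<le> \<delta>"
proof (rule field_le_epsilon)
  fix e :: real assume e: "e > 0"
  obtain d where d: "d > 0"
    "\<And>y. norm (y - z) < d \<Longrightarrow> norm (f y - f z - (y - z) \<bullet> g) \<le> e * norm (y - z)"
    using der e unfolding gderiv_def has_derivative_at_alt by blast
  obtain d' where d': "d' > 0"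
    "\<And>y. y \<noteq> z \<Longrightarrow> dist y z < d' \<Longrightarrow> f z \<le> f y + \<delta> * norm (y - z)"
    using min unfolding eventually_at by blast
  show "norm g \<le> \<delta> + e"
  proof (cases "g = 0")
    case False
    define s where "s = min d d' / (2 * norm g)"
    define y where "y = z - s *\<^sub>R g"
    have s: "s > 0" using d d' False by (simp add: s_def)
    have "norm (y - z) = min d d' / 2"
      using s False d d' by (simp add: y_def) (simp add: s_def)
    then have "norm (y - z) < d" "norm (y - z) < d'" "y \<noteq> z"
      using d(1) d'(1) by auto
    then have "f z \<le> f y + \<delta> * norm (y - z)"
      and "norm (f y - f z - (y - z) \<bullet> g) \<le> e * norm (y - z)"
      using d(2) d'(2) by (auto simp: dist_norm)
    then have "- ((y - z) \<bullet> g) \<le> (\<delta> + e) * norm (y - z)"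
      by (simp add: algebra_simps abs_le_iff)
    then have "s * (norm g * norm g) \<le> (\<delta> + e) * (s * norm g)"
      using s by (simp add: y_def flip: power2_norm_eq_inner power2_eq_square)
    then show ?thesis using s False by (simp add: mult.assoc[symmetric] mult.commute[of s])
  qed (use e assms in simp)
qed

text \<open>Replacing the sequences in the definition by a single approximation for every tolerance turns the diagonal argument behind
\<open>normal_cone_closed_graph\<close> into a triangle inequality.\<close>

lemma normal_cone_iff:
  "v \<in> normal_cone C x \<longleftrightarrow>
     x \<in> C \<and> (\<forall>e>0. \<exists>y\<in>C. \<exists>w\<in>regular_normal_cone C y. dist y x < e \<and> dist w v < e)"
  (is "_ \<longleftrightarrow> x \<in> C \<and> ?R")
proof (cases "x \<in> C")
  case x: True
  show ?thesis
  proof (intro iffI conjI x)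
    assume "v \<in> normal_cone C x"
    then obtain y w where yw: "y \<longlonglongrightarrow> x" "w \<longlonglongrightarrow> v" "\<And>k::nat. y k \<in> C"
        "\<And>k. w k \<in> regular_normal_cone C (y k)"
      using x by (auto simp: normal_cone_def)
    show ?R
    proof (intro allI impI)
      fix e :: real assume "e > 0"
      then have "\<forall>\<^sub>F k in sequentially. dist (y k) x < e" "\<forall>\<^sub>F k in sequentially. dist (w k) v < e"
        using yw(1,2) tendstoD by blast+
      then have "\<forall>\<^sub>F k in sequentially. dist (y k) x < e \<and> dist (w k) v < e"
        by eventually_elim simp
      then obtain k where "dist (y k) x < e" "dist (w k) v < e"
        by (auto simp: eventually_sequentially)
      then show "\<exists>y\<in>C. \<exists>w\<in>regular_normal_cone C y. dist y x < e \<and> dist w v < e"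
        using yw by blast
    qed
  next
    assume "x \<in> C \<and> ?R"
    then have "\<forall>k. \<exists>y w. y \<in> C \<and> w \<in> regular_normal_cone C y
        \<and> dist y x < inverse (real (Suc k)) \<and> dist w v < inverse (real (Suc k))"
      by (metis inverse_positive_iff_positive of_nat_0_less_iff zero_less_Suc)
    then obtain y w where yw: "\<And>k. y k \<in> C" "\<And>k. w k \<in> regular_normal_cone C (y k)"
        "\<And>k. dist (y k) x < inverse (real (Suc k))" "\<And>k. dist (w k) v < inverse (real (Suc k))"
      by metis
    have conv: "f \<longlonglongrightarrow> l" if "\<And>k. dist (f k) l < inverse (real (Suc k))"
      for f :: "nat \<Rightarrow> 'a" and l
      by (rule metric_tendsto_imp_tendsto[OF LIMSEQ_inverse_real_of_nat])
        (intro always_eventually allI, use that in \<open>simp add: less_imp_le\<close>)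
    have "y \<longlonglongrightarrow> x" "w \<longlonglongrightarrow> v"
      using yw(3,4) by (auto intro: conv)
    then show "v \<in> normal_cone C x"
      using x yw(1,2) unfolding normal_cone_def by auto
  qed
qed (simp add: normal_cone_def)

lemma normal_cone_closed_graph:
  assumes "x \<in> C" "y \<longlonglongrightarrow> x" "w \<longlonglongrightarrow> v" "\<forall>\<^sub>F k in sequentially. w k \<in> normal_cone C (y k)"
  shows "v \<in> normal_cone C x"
  unfolding normal_cone_iff
proof (intro conjI allI impI)
  fix e :: real assume e: "e > 0"
  then have "\<forall>\<^sub>F k in sequentially. dist (y k) x < e/2" "\<forall>\<^sub>F k in sequentially. dist (w k) v < e/2"
    using assms tendstoD half_gt_zero by blast+
  with assms(4) have "\<forall>\<^sub>F k in sequentially. dist (y k) x < e/2 \<and> dist (w k) v < e/2 \<and>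
      w k \<in> normal_cone C (y k)"
    by eventually_elim simp
  then obtain k where k: "dist (y k) x < e/2" "dist (w k) v < e/2" "w k \<in> normal_cone C (y k)"
    by (auto simp: eventually_sequentially)
  then obtain y' w' where "y' \<in> C" "w' \<in> regular_normal_cone C y'" "dist y' (y k) < e/2" "dist w' (w k) < e/2"
    using e unfolding normal_cone_iff by (meson half_gt_zero)
  then show "\<exists>y\<in>C. \<exists>w\<in>regular_normal_cone C y. dist y x < e \<and> dist w v < e"
    using k dist_triangle_half_r dist_triangle_half_l by (metis dist_commute)
qed fact

lemma regular_normal_cone_subset_normal_cone:
  "regular_normal_cone C x \<subseteq> normal_cone C x"
proof
  fix v assume v: "v \<in> regular_normal_cone C x"
  then have "x \<in> C" by (simp add: regular_normal_cone_iff)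
  with v show "v \<in> normal_cone C x"
    unfolding normal_cone_iff by (intro conjI allI impI bexI[of _ x] bexI[of _ v]) auto
qed

lemma normal_cone_scaleR:
  assumes "v \<in> normal_cone C x" "0 \<le> c"
  shows "c *\<^sub>R v \<in> normal_cone C x"
proof -
  from assms(1) have x: "x \<in> C" by (simp add: normal_cone_iff)
  obtain y w where yw: "y \<longlonglongrightarrow> x" "w \<longlonglongrightarrow> v" "\<And>k::nat. y k \<in> C"
        "\<And>k. w k \<in> regular_normal_cone C (y k)"
    using assms x by (auto simp: normal_cone_def)
  have "\<And>k. c *\<^sub>R w k \<in> regular_normal_cone C (y k)"
    using yw assms by (simp add: regular_normal_cone_scaleR)
  moreover have "(\<lambda>k. c *\<^sub>R w k) \<longlonglongrightarrow> c *\<^sub>R v"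
    using yw(2) by (intro tendsto_intros)
  ultimately have "\<exists>y w'. y \<longlonglongrightarrow> x \<and> (\<forall>k::nat. y k \<in> C) \<and> w' \<longlonglongrightarrow> c *\<^sub>R v
      \<and> (\<forall>k. w' k \<in> regular_normal_cone C (y k))"
    using yw by (intro exI[of _ y] exI[of _ "\<lambda>k. c *\<^sub>R w k"]) blast
  then show ?thesis
    using x by (simp add: normal_cone_def)
qed

lemma zero_mem_regular_normal_cone: "x \<in> C \<Longrightarrow> 0 \<in> regular_normal_cone C x"
  unfolding regular_normal_cone_iff by (auto intro!: always_eventually)

text \<open>Dropping an initial segment makes all step sizes positive; the points converge to \<open>x\<close> because the difference
quotients converge and the steps vanish.\<close>

lemma tangent_cone_memE:
  assumes "t \<in> tangent_cone C x"
  obtains h c where "h \<longlonglongrightarrow> (0::real)" "\<And>k. h k > 0" "\<And>k::nat. c k \<in> C"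
    "(\<lambda>k. (c k - x) /\<^sub>R h k) \<longlonglongrightarrow> t" "c \<longlonglongrightarrow> x"
proof -
  have "t \<in> outer_limit (at_right (0::real)) (\<lambda>t. {(c - x) /\<^sub>R t | c. c \<in> C})"
    using assms by (simp add: tangent_cone_def split: if_splits)
  then obtain i z where iz: "filterlim i (at_right (0::real)) sequentially"
    "\<And>k::nat. z k \<in> {(c - x) /\<^sub>R i k | c. c \<in> C}" "z \<longlonglongrightarrow> t"
    unfolding outer_limit_def by blast
  then obtain c where c: "\<And>k. c k \<in> C" "\<And>k. z k = (c k - x) /\<^sub>R i k"
    by (simp add: set_eq_iff) metis
  have i: "i \<longlonglongrightarrow> 0" "\<forall>\<^sub>F k in sequentially. i k > 0"
    using iz(1) by (auto simp: filterlim_at elim: eventually_mono)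
  then obtain K where K: "\<And>k. k \<ge> K \<Longrightarrow> i k > 0"
    by (auto simp: eventually_sequentially)
  define h where "h k = i (k + K)" for k
  have h: "h \<longlonglongrightarrow> 0" "\<And>k. h k > 0"
    using LIMSEQ_ignore_initial_segment[OF i(1), of K] K by (simp_all add: h_def[abs_def])
  have quot: "(\<lambda>k. (c (k + K) - x) /\<^sub>R h k) \<longlonglongrightarrow> t"
    using LIMSEQ_ignore_initial_segment[OF iz(3), of K] by (simp add: c h_def)
  have "(\<lambda>k. h k *\<^sub>R ((c (k + K) - x) /\<^sub>R h k)) \<longlonglongrightarrow> 0 *\<^sub>R t"
    by (intro tendsto_intros h quot)
  then have "(\<lambda>k. c (k + K) - x) \<longlonglongrightarrow> 0"
    using h(2) by (simp add: less_imp_neq[symmetric])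
  then have "(\<lambda>k. c (k + K)) \<longlonglongrightarrow> x" by (simp add: LIM_zero_iff)
  with h quot c(1) show ?thesis by (intro that[of h "\<lambda>k. c (k + K)"])
qed

lemma tangent_cone_memI:
  assumes "x \<in> C" "h \<longlonglongrightarrow> (0::real)" "\<And>k. h k > 0" "\<And>k::nat. c k \<in> C"
    "(\<lambda>k. (c k - x) /\<^sub>R h k) \<longlonglongrightarrow> t"
  shows "t \<in> tangent_cone C x"
proof -
  have "filterlim h (at_right 0) sequentially"
    using assms(2,3) by (auto simp: filterlim_at less_imp_neq[symmetric])
  moreover have "(c k - x) /\<^sub>R h k \<in> {(c - x) /\<^sub>R h k | c. c \<in> C}" for k
    using assms(4) by blast
  ultimately have "t \<in> outer_limit (at_right 0) (\<lambda>t. {(c - x) /\<^sub>R t | c. c \<in> C})"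
    unfolding outer_limit_def mem_Collect_eq using assms(5)
    by (intro exI[of _ h] exI[of _ "\<lambda>k. (c k - x) /\<^sub>R h k"]) blast
  then show ?thesis
    using assms(1) by (simp add: tangent_cone_def)
qed

lemma regular_normal_inner_tangent_le:
  assumes v: "v \<in> regular_normal_cone C x" and t: "t \<in> tangent_cone C x"
  shows "v \<bullet> t \<le> 0"
proof -
  obtain h c where hc: "h \<longlonglongrightarrow> (0::real)" "\<And>k. h k > 0" "\<And>k::nat. c k \<in> C"
    "(\<lambda>k. (c k - x) /\<^sub>R h k) \<longlonglongrightarrow> t" and c: "c \<longlonglongrightarrow> x"
    using tangent_cone_memE[OF t] by blast
  have "v \<bullet> t \<le> e * norm t" if e: "e > 0" for e
  proof -
    have "\<forall>\<^sub>F y in at x within C. v \<bullet> (y - x) \<le> e * norm (y - x)"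
      using v e by (simp add: regular_normal_cone_iff)
    then have "\<forall>\<^sub>F y in inf (nhds x) (principal C). v \<bullet> (y - x) \<le> e * norm (y - x)"
      unfolding at_within_def eventually_inf_principal
      by (auto elim!: eventually_mono)
    moreover have "filterlim c (inf (nhds x) (principal C)) sequentially"
      using c hc(3) by (simp add: filterlim_inf filterlim_principal)
    ultimately have "\<forall>\<^sub>F k in sequentially. v \<bullet> (c k - x) \<le> e * norm (c k - x)"
      by (rule eventually_compose_filterlim)
    then have "\<forall>\<^sub>F k in sequentially. v \<bullet> ((c k - x) /\<^sub>R h k) \<le> e * norm ((c k - x) /\<^sub>R h k)"
    proof eventually_elim
      case (elim k)
      then show ?case using hc(2)[of k] by (simp add: divide_inverse mult.left_commute)
    qed
    moreover have "(\<lambda>k. v \<bullet> ((c k - x) /\<^sub>R h k)) \<longlonglongrightarrow> v \<bullet> t"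
      "(\<lambda>k. e * norm ((c k - x) /\<^sub>R h k)) \<longlonglongrightarrow> e * norm t"
      using hc(4) by (intro tendsto_intros; assumption)+
    ultimately show ?thesis
      by (intro tendsto_le[OF sequentially_bot])
  qed
  then have bound: "\<forall>\<^sub>F e in at_right 0. v \<bullet> t \<le> e * norm t"
    by (simp add: eventually_at_filter)
  have "((\<lambda>e. e * norm t) \<longlongrightarrow> 0) (at_right 0)"
    by (auto intro!: tendsto_eq_intros)
  from tendsto_lowerbound[OF this bound] show ?thesis by simp
qed

section \<open>Level sets with independent gradients\<close>

lemma span_image_imp_sum:
  assumes "finite I" "y \<in> span (g ` I)"
  shows "\<exists>l. y = (\<Sum>i\<in>I. l i *\<^sub>R (g i :: 'a::real_vector))"
  using assms(2)
proof (induction rule: span_induct_alt)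
  case base
  show ?case by (rule exI[of _ "\<lambda>_. 0"]) simp
next
  case (step c x y)
  then obtain j l where j: "j \<in> I" "x = g j" "y = (\<Sum>i\<in>I. l i *\<^sub>R g i)" by blast
  have "(\<Sum>i\<in>I. (if i = j then c else 0) *\<^sub>R g i) = (\<Sum>i\<in>I. if i = j then c *\<^sub>R g i else 0)"
    by (intro sum.cong) auto
  then have "(\<Sum>i\<in>I. ((if i = j then c else 0) + l i) *\<^sub>R g i) = c *\<^sub>R x + y"
    using j assms(1) by (simp add: scaleR_add_left sum.distrib)
  then show ?case by metis
qed

text \<open>Each coefficient is a linear functional of the combination, read off by a functional dual to the independent vectors \<open>g
i\<close>, and linear functionals are bounded.\<close>

lemma full_rank_coefficient_bound:
  fixes g :: "nat \<Rightarrow> 'a::euclidean_space"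
  assumes dim: "dim (g ` {..<k}) = k"
  obtains b where "b > 0" "\<And>l. b * (\<Sum>i<k. \<bar>l i\<bar>) \<le> norm (\<Sum>i<k. l i *\<^sub>R g i)"
proof -
  have card_le: "card (g ` {..<k}) \<le> k"
    using card_image_le[of "{..<k}" g] by simp
  have "dim (g ` {..<k}) \<le> card (g ` {..<k})"
    by (rule dim_le_card') simp
  with card_le dim have card: "card (g ` {..<k}) = card {..<k}" by simp
  then have inj: "inj_on g {..<k}"
    by (simp add: eq_card_imp_inj_on)
  have ind: "independent (g ` {..<k})"
    using dim card by (intro card_le_dim_spanning[of _ "g ` {..<k}"]) (auto simp: span_superset)
  have "\<exists>f B. B > 0 \<and> (\<forall>x. \<bar>f x\<bar> \<le> B * norm x) \<and>
      (\<forall>l. f (\<Sum>i<k. l i *\<^sub>R g i) = l j)" if j: "j < k" for j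
  proof -
    obtain f :: "'a \<Rightarrow> real" where f: "linear f" "\<And>x. x \<in> g ` {..<k} \<Longrightarrow> f x = (if x = g j then 1 else 0)"
      using linear_independent_extend[OF ind, of "\<lambda>x. if x = g j then 1 else 0"] by blast
    have fg: "f (g i) = (if i = j then 1 else 0)" if "i < k" for i
      using f(2) that j inj by (auto simp: inj_on_eq_iff)
    have "f (\<Sum>i<k. l i *\<^sub>R g i) = l j" for l
    proof -
      have "f (\<Sum>i<k. l i *\<^sub>R g i) = (\<Sum>i<k. l i * f (g i))"
        using f(1) by (simp add: linear_sum linear_cmul)
      also have "\<dots> = (\<Sum>i<k. if i = j then l i else 0)"
        by (intro sum.cong) (auto simp: fg)
      finally show ?thesis using j by simp
    qed
    moreover obtain B where "B > 0" "\<And>x. norm (f x) \<le> B * norm x"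
      using linear_bounded_pos[OF f(1)] by blast
    ultimately show ?thesis by auto
  qed
  then obtain f :: "nat \<Rightarrow> 'a \<Rightarrow> real" and B where
    f: "\<And>j. j < k \<Longrightarrow> B j > 0" "\<And>j x. j < k \<Longrightarrow> \<bar>f j x\<bar> \<le> B j * norm x"
      "\<And>j l. j < k \<Longrightarrow> f j (\<Sum>i<k. l i *\<^sub>R g i) = l j"
    by metis
  have s0: "0 \<le> (\<Sum>j<k. B j)" using f(1) by (auto intro: sum_nonneg less_imp_le)
  show ?thesis
  proof
    show "0 < 1 / (1 + (\<Sum>j<k. B j))" using s0 by simp
    fix l :: "nat \<Rightarrow> real"
    have "\<bar>l j\<bar> \<le> B j * norm (\<Sum>i<k. l i *\<^sub>R g i)" if "j < k" for j
      using f(2)[OF that, of "\<Sum>i<k. l i *\<^sub>R g i"] f(3)[OF that] by simp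
    then have "(\<Sum>j<k. \<bar>l j\<bar>) \<le> (\<Sum>j<k. B j * norm (\<Sum>i<k. l i *\<^sub>R g i))"
      by (intro sum_mono) auto
    also have "\<dots> \<le> (1 + (\<Sum>j<k. B j)) * norm (\<Sum>i<k. l i *\<^sub>R g i)"
      by (simp add: sum_distrib_right distrib_right)
    finally show "1 / (1 + (\<Sum>j<k. B j)) * (\<Sum>i<k. \<bar>l i\<bar>) \<le> norm (\<Sum>i<k. l i *\<^sub>R g i)"
      using s0 by (simp add: divide_le_eq mult.commute)
  qed
qed

text \<open>Full rank at a single point is replaced by the uniform bound \<open>c\<close> on a ball, a quantitative form of the linear
independence of the gradients \<open>G i x\<close> that survives perturbation of \<open>x\<close>.\<close>

locale regular_level_set =
  fixes X :: "'a::euclidean_space set" and F :: "nat \<Rightarrow> 'a \<Rightarrow> real" and G :: "nat \<Rightarrow> 'a \<Rightarrow> 'a"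
    and k :: nat and x0 :: 'a and r c :: real
  assumes c: "0 < c"
    and grad: "x \<in> ball x0 r \<Longrightarrow> i < k \<Longrightarrow> GDERIV (F i) x :> G i x"
    and cont: "i < k \<Longrightarrow> continuous_on (ball x0 r) (G i)"
    and zero: "x \<in> ball x0 r \<Longrightarrow> x \<in> X \<longleftrightarrow> (\<forall>i<k. F i x = 0)"
    and nondeg: "x \<in> ball x0 r \<Longrightarrow> c * (\<Sum>i<k. \<bar>l i\<bar>) \<le> norm (\<Sum>i<k. l i *\<^sub>R G i x)"
begin

definition kernel :: "'a \<Rightarrow> 'a set" where
  "kernel x = {t. \<forall>i<k. G i x \<bullet> t = 0}"

lemma subspace_kernel: "subspace (kernel x)"
  by (auto simp: kernel_def subspace_def inner_add_right)

text \<open>The orthogonal complement of the kernel is spanned by the gradients.\<close>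

lemma kernel_residual:
  obtains l where "v - closest_point (kernel x) v = (\<Sum>i<k. l i *\<^sub>R G i x)"
proof -
  obtain y z where yz: "y \<in> span ((\<lambda>i. G i x) ` {..<k})"
    "\<And>w. w \<in> span ((\<lambda>i. G i x) ` {..<k}) \<Longrightarrow> orthogonal z w" "v = y + z"
    using orthogonal_subspace_decomp_exists by blast
  obtain l where l: "y = (\<Sum>i<k. l i *\<^sub>R G i x)"
    using span_image_imp_sum[OF _ yz(1)] by auto
  have "closest_point (kernel x) v = z"
  proof (rule closest_point_eq_of_orthogonal[OF subspace_kernel])
    have "z \<bullet> G i x = 0" if "i < k" for i
      using yz(2)[of "G i x"] that by (simp add: span_base orthogonal_def)
    then show "z \<in> kernel x"
      by (simp add: kernel_def inner_commute)
    fix t assume "t \<in> kernel x"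
    then have "y \<bullet> t = 0"
      unfolding l by (simp add: inner_sum_left kernel_def)
    then show "(v - z) \<bullet> t = 0" by (simp add: yz(3))
  qed
  then show ?thesis using that l yz(3) by simp
qed

text \<open>A combination of gradients has coefficients of size at most its norm over \<open>c\<close>, so almost orthogonality to each
gradient gives almost orthogonality to the combination.\<close>

lemma normal_combination_inner_le:
  assumes y: "y \<in> ball x0 r" and p: "\<And>i. i < k \<Longrightarrow> \<bar>G i y \<bullet> p\<bar> \<le> e"
  shows "\<bar>(\<Sum>i<k. l i *\<^sub>R G i y) \<bullet> p\<bar> \<le> e / c * norm (\<Sum>i<k. l i *\<^sub>R G i y)"
proof (cases "k = 0")
  case False
  then have e: "0 \<le> e" using p[of 0] by (meson abs_ge_zero order_trans neq0_conv)
  have "\<bar>(\<Sum>i<k. l i *\<^sub>R G i y) \<bullet> p\<bar> \<le> (\<Sum>i<k. \<bar>l i * (G i y \<bullet> p)\<bar>)"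
    by (simp add: inner_sum_left sum_abs)
  also have "\<dots> \<le> (\<Sum>i<k. \<bar>l i\<bar> * e)"
    using p by (intro sum_mono) (simp add: abs_mult mult_left_mono)
  also have "\<dots> = e / c * (c * (\<Sum>i<k. \<bar>l i\<bar>))"
    using c by (simp add: sum_distrib_left mult.commute)
  also have "\<dots> \<le> e / c * norm (\<Sum>i<k. l i *\<^sub>R G i y)"
    using e c nondeg[OF y] by (intro mult_left_mono) auto
  finally show ?thesis .
qed simp

lemma gradients_close:
  assumes x: "x \<in> ball x0 r" and e: "e > 0"
  obtains d where "d > 0" "ball x d \<subseteq> ball x0 r"
    "\<And>y i. y \<in> ball x d \<Longrightarrow> i < k \<Longrightarrow> norm (G i y - G i x) \<le> e"
proof -
  have "\<forall>\<^sub>F y in nhds x. dist (G i y) (G i x) < e" if "i < k" for i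
  proof -
    have "isCont (G i) x"
      using cont[OF that] x by (simp add: continuous_on_eq_continuous_at)
    then show ?thesis
      using e by (metis continuous_at isCont_def tendstoD tendsto_at_iff_tendsto_nhds)
  qed
  then have "\<forall>\<^sub>F y in nhds x. \<forall>i\<in>{..<k}. dist (G i y) (G i x) < e"
    by (intro eventually_ball_finite) auto
  moreover have "\<forall>\<^sub>F y in nhds x. y \<in> ball x0 r"
    using x by (intro eventually_nhds_in_open) auto
  ultimately have "\<forall>\<^sub>F y in nhds x. y \<in> ball x0 r \<and> (\<forall>i<k. dist (G i y) (G i x) < e)"
    by eventually_elim simp
  then obtain d where "d > 0" "\<And>y. dist y x < d \<Longrightarrow> y \<in> ball x0 r \<and> (\<forall>i<k. dist (G i y) (G i x) < e)"
    by (auto simp: eventually_nhds_metric)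
  then show ?thesis
    by (intro that[of d]) (auto simp: dist_commute simp flip: dist_norm intro: less_imp_le)
qed

text \<open>For \<open>p = P(y) v\<close> and \<open>q = P(x) v\<close> one has
\<open>|p - q|\<^sup>2 = (v - q) \<bullet> p + (v - p) \<bullet> q\<close>. Each term pairs a combination of gradients at one point
with a vector orthogonal to the gradients at the other point, so it is small when the gradients
at the two points are close.\<close>

lemma kernel_projections_close:
  assumes x: "x \<in> ball x0 r" and y: "y \<in> ball x0 r" and e: "0 \<le> e"
    and G: "\<And>i. i < k \<Longrightarrow> norm (G i y - G i x) \<le> e"
  shows "(norm (closest_point (kernel y) v - closest_point (kernel x) v))\<^sup>2 \<le> 2 * e / c * (norm v)\<^sup>2"
proof -
  have *: "\<bar>(v - closest_point (kernel b) v) \<bullet> closest_point (kernel a) v\<bar> \<le> e / c * (norm v)\<^sup>2"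
    if ab: "a \<in> ball x0 r" "b \<in> ball x0 r" "\<And>i. i < k \<Longrightarrow> norm (G i b - G i a) \<le> e" for a b
  proof -
    let ?p = "closest_point (kernel a) v"
    obtain l where l: "v - closest_point (kernel b) v = (\<Sum>i<k. l i *\<^sub>R G i b)"
      by (rule kernel_residual)
    have "\<bar>G i b \<bullet> ?p\<bar> \<le> e * norm v" if i: "i < k" for i
    proof -
      have "G i b \<bullet> ?p = (G i b - G i a) \<bullet> ?p"
        using closest_point_mem[OF subspace_kernel, of a v] i by (simp add: kernel_def inner_diff_left)
      also have "\<bar>\<dots>\<bar> \<le> norm (G i b - G i a) * norm ?p"
        by (rule Cauchy_Schwarz_ineq2)
      also have "\<dots> \<le> e * norm v"
        using ab(3)[OF i] e norm_closest_point_le(1)[OF subspace_kernel] by (intro mult_mono) auto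
      finally show ?thesis .
    qed
    then have "\<bar>(v - closest_point (kernel b) v) \<bullet> ?p\<bar> \<le> e * norm v / c * norm (v - closest_point (kernel b) v)"
      unfolding l by (rule normal_combination_inner_le[OF ab(2)])
    also have "\<dots> \<le> e * norm v / c * norm v"
      using e c norm_closest_point_le(2)[OF subspace_kernel] by (intro mult_left_mono) auto
    finally show ?thesis by (simp add: power2_eq_square)
  qed
  define p where "p = closest_point (kernel y) v"
  define q where "q = closest_point (kernel x) v"
  have orth: "(v - p) \<bullet> p = 0" "(v - q) \<bullet> q = 0"
    unfolding p_def q_def by (intro closest_point_residual closest_point_mem subspace_kernel)+
  have "\<bar>(v - q) \<bullet> p\<bar> \<le> e / c * (norm v)\<^sup>2" "\<bar>(v - p) \<bullet> q\<bar> \<le> e / c * (norm v)\<^sup>2"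
    unfolding p_def q_def using *[OF y x] *[OF x y] G by (auto simp: norm_minus_commute)
  moreover have "(norm (p - q))\<^sup>2 = (v - q) \<bullet> p + (v - p) \<bullet> q"
    using orth by (simp add: power2_norm_eq_inner inner_diff_left inner_diff_right inner_commute)
  ultimately show ?thesis
    unfolding p_def[symmetric] q_def[symmetric] by (simp add: abs_le_iff)
qed

text \<open>All constraints vanish at \<open>y\<close> and at \<open>z\<close>, so by the mean value theorem \<open>z - y\<close> is orthogonal to
each gradient at some intermediate point, hence almost orthogonal to the gradient at \<open>y\<close>. The
residual is a combination of these gradients and its inner product with \<open>z - y\<close> is its squared
norm.\<close>

lemma chord_residual_le:
  assumes e: "0 \<le> e" and d: "ball x d \<subseteq> ball x0 r"
    and G: "\<And>y i. y \<in> ball x d \<Longrightarrow> i < k \<Longrightarrow> norm (G i y - G i x) \<le> e"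
    and y: "y \<in> X \<inter> ball x d" and z: "z \<in> X \<inter> ball x d"
  shows "norm ((z - y) - closest_point (kernel y) (z - y)) \<le> 2 * e / c * norm (z - y)"
proof -
  let ?n = "(z - y) - closest_point (kernel y) (z - y)"
  have "\<bar>G i y \<bullet> (z - y)\<bar> \<le> 2 * e * norm (z - y)" if i: "i < k" for i
  proof -
    have seg: "y + s *\<^sub>R (z - y) \<in> ball x d" if "0 \<le> s" "s \<le> 1" for s
    proof -
      have "(1 - s) *\<^sub>R y + s *\<^sub>R z \<in> ball x d"
        using y z that by (intro convexD_alt[OF convex_ball]) auto
      then show ?thesis by (simp add: algebra_simps)
    qed
    have "\<exists>s\<in>{0..1}. F i (y + 1 *\<^sub>R (z - y)) - F i (y + 0 *\<^sub>R (z - y))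
        = (\<lambda>h. (h *\<^sub>R (z - y)) \<bullet> G i (y + s *\<^sub>R (z - y))) (1 - 0)"
    proof (rule mvt_very_simple)
      fix s :: real assume s: "0 \<le> s" "s \<le> 1"
      have D: "(F i has_derivative (\<lambda>h. h \<bullet> G i (y + s *\<^sub>R (z - y)))) (at (y + s *\<^sub>R (z - y)))"
        using grad[OF subsetD[OF d seg[OF s]] i] by (simp add: gderiv_def)
      have "((\<lambda>s. y + s *\<^sub>R (z - y)) has_derivative (\<lambda>h. h *\<^sub>R (z - y))) (at s within {0..1})"
        by (auto intro!: derivative_eq_intros)
      from has_derivative_compose[OF this D]
      show "((\<lambda>s. F i (y + s *\<^sub>R (z - y))) has_derivative
          (\<lambda>h. (h *\<^sub>R (z - y)) \<bullet> G i (y + s *\<^sub>R (z - y)))) (at s within {0..1})" .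
    qed simp
    then obtain s where s: "0 \<le> s" "s \<le> 1" "F i z - F i y = (z - y) \<bullet> G i (y + s *\<^sub>R (z - y))"
      by auto
    let ?w = "y + s *\<^sub>R (z - y)"
    have "F i z = 0" "F i y = 0"
      using y z d zero i by blast+
    with s(3) have "(z - y) \<bullet> G i ?w = 0" by simp
    then have "G i y \<bullet> (z - y) = (G i y - G i ?w) \<bullet> (z - y)"
      by (simp only: inner_diff_left[of "G i y"] inner_commute[of "G i ?w"] diff_zero)
    also have "\<bar>\<dots>\<bar> \<le> norm (G i y - G i ?w) * norm (z - y)"
      by (rule Cauchy_Schwarz_ineq2)
    also have "norm (G i y - G i ?w) \<le> norm (G i y - G i x) + norm (G i ?w - G i x)"
      by (metis diff_diff_eq2 norm_triangle_ineq4 diff_add_cancel)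
    also have "\<dots> \<le> 2 * e"
      using G[OF _ i, of y] G[OF seg[OF s(1,2)] i] y by simp
    finally show ?thesis by (simp add: mult_right_mono)
  qed
  moreover obtain l where l: "?n = (\<Sum>i<k. l i *\<^sub>R G i y)"
    by (rule kernel_residual)
  moreover have yb: "y \<in> ball x0 r" using y d by auto
  ultimately have "\<bar>?n \<bullet> (z - y)\<bar> \<le> (2 * e * norm (z - y)) / c * norm ?n"
    using normal_combination_inner_le[OF yb] by metis
  moreover have "?n \<bullet> (z - y) = norm ?n * norm ?n"
  proof -
    have "?n \<bullet> closest_point (kernel y) (z - y) = 0"
      by (intro closest_point_residual closest_point_mem subspace_kernel)
    then have "?n \<bullet> (z - y) = ?n \<bullet> ?n"
      by (simp add: inner_diff_right)
    then show ?thesis by (simp add: power2_norm_eq_inner flip: power2_eq_square)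
  qed
  ultimately have "norm ?n * norm ?n \<le> (2 * e / c * norm (z - y)) * norm ?n" by simp
  then show ?thesis
  proof (cases "norm ?n = 0")
    case False
    with \<open>norm ?n * norm ?n \<le> _\<close> show ?thesis
      by (simp only: mult_le_cancel_right) (meson norm_ge_zero not_le order.order_iff_strict)
  qed (use e c in simp)
qed

lemma continuous_on_constraint:
  assumes "i < k" shows "continuous_on (ball x0 r) (F i)"
proof -
  have "isCont (F i) y" if "y \<in> ball x0 r" for y
    using grad[OF that assms] unfolding gderiv_def by (rule has_derivative_continuous)
  then show ?thesis by (simp add: continuous_at_imp_continuous_on)
qed

text \<open>The distance from a nearby point \<open>y\<close> to the level set is controlled by the constraint violation.
Minimise \<open>|F z| + (c / 2) |z - y|\<close> over a ball. At a minimiser with \<open>F z \<noteq> 0\<close> the gradient of \<open>|F|\<close>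
would have norm at most \<open>c / 2\<close>; but it is a combination of the gradients with coefficient
vector of Euclidean norm \<open>1\<close>, so its norm is at least \<open>c\<close>. Hence the minimiser lies on the level
set, and comparison with the value at \<open>y\<close> bounds its distance from \<open>y\<close>.\<close>

lemma level_set_error_bound:
  assumes x: "x \<in> X \<inter> ball x0 r"
  obtains \<rho> where "\<rho> > 0" "ball x \<rho> \<subseteq> ball x0 r"
    "\<And>y. y \<in> ball x \<rho> \<Longrightarrow> \<exists>z\<in>X. c / 2 * norm (z - y) \<le> (\<Sum>i<k. \<bar>F i y\<bar>)"
proof -
  define \<phi> where "\<phi> y = L2_set (\<lambda>i. F i y) {..<k}" for y
  obtain s where s: "s > 0" "cball x s \<subseteq> ball x0 r"
    using x open_contains_cball[of "ball x0 r"] by (metis IntD2 open_ball)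
  have cont_\<phi>: "continuous_on (ball x0 r) \<phi>"
    unfolding \<phi>_def L2_set_def using continuous_on_constraint
    by (intro continuous_intros) auto
  have \<phi>x: "\<phi> x = 0"
    using x zero[of x] by (simp add: \<phi>_def L2_set_def)
  have "isCont \<phi> x"
    using cont_\<phi> x by (simp add: continuous_on_eq_continuous_at)
  then obtain d where d: "d > 0" "\<And>y. dist y x < d \<Longrightarrow> dist (\<phi> y) (\<phi> x) < c * s / 4"
    unfolding continuous_at_eps_delta using s c by (metis divide_pos_pos mult_pos_pos zero_less_numeral)
  show ?thesis
  proof
    show "0 < min d (s / 2)" using d s by simp
    show "ball x (min d (s / 2)) \<subseteq> ball x0 r"
      using s by (auto intro!: subsetD[OF s(2)])
    fix y assume y: "y \<in> ball x (min d (s / 2))"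
    have \<phi>y: "\<phi> y < c * s / 4"
      using d(2)[of y] y \<phi>x by (simp add: dist_commute dist_real_def)
    \<comment> \<open>Any penalty slope strictly below \<open>c\<close> would do: off the level set \<open>\<phi>\<close> has slope at least \<open>c\<close>.\<close>
    define \<psi> where "\<psi> z = \<phi> z + c / 2 * norm (z - y)" for z
    have "continuous_on (cball x s) \<psi>"
      unfolding \<psi>_def using continuous_on_subset[OF cont_\<phi> s(2)] by (intro continuous_intros)
    then obtain z where z: "z \<in> cball x s" "\<And>w. w \<in> cball x s \<Longrightarrow> \<psi> z \<le> \<psi> w"
      using continuous_attains_inf[of "cball x s" \<psi>] s by auto
    have "\<psi> z \<le> \<psi> y"
      using y s by (intro z) auto
    then have zy: "\<phi> z + c / 2 * norm (z - y) \<le> \<phi> y" by (simp add: \<psi>_def)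
    have \<phi>z0: "0 \<le> \<phi> z" by (simp add: \<phi>_def)
    have "c * norm (z - y) < c * (s / 2)"
      using zy \<phi>y \<phi>z0 by simp
    then have "norm (z - y) < s / 2" using c by simp
    then have zs: "z \<in> ball x s"
      using y dist_triangle[of x z y] by (simp add: dist_norm norm_minus_commute)
    have zr: "z \<in> ball x0 r" using z s by blast
    have "\<phi> z = 0"
    proof (rule ccontr)
      assume "\<phi> z \<noteq> 0"
      then have pos: "\<phi> z > 0" using \<phi>z0 by simp
      define g where "g = (\<Sum>i<k. (F i z / \<phi> z) *\<^sub>R G i z)"
      have q: "GDERIV (\<lambda>z. \<Sum>i<k. (F i z)\<^sup>2) z :> 2 *\<^sub>R (\<Sum>i<k. F i z *\<^sub>R G i z)"
      proof -
        have "((\<lambda>z. (F i z)\<^sup>2) has_derivative (\<lambda>h. 2 * F i z * (h \<bullet> G i z))) (at z)" if "i < k" for i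
          using grad[OF zr that] unfolding gderiv_def
          by (auto intro!: derivative_eq_intros)
        then have "((\<lambda>z. \<Sum>i<k. (F i z)\<^sup>2) has_derivative (\<lambda>h. \<Sum>i<k. 2 * F i z * (h \<bullet> G i z))) (at z)"
          by (intro has_derivative_sum) auto
        then show ?thesis
          by (simp add: gderiv_def inner_sum_right sum_distrib_left mult.assoc)
      qed
      have sq: "\<phi> z = sqrt (\<Sum>i<k. (F i z)\<^sup>2)" "0 < (\<Sum>i<k. (F i z)\<^sup>2)"
        using pos by (auto simp: \<phi>_def L2_set_def)
      have "GDERIV (\<lambda>z. sqrt (\<Sum>i<k. (F i z)\<^sup>2)) z :>
          (inverse (sqrt (\<Sum>i<k. (F i z)\<^sup>2)) / 2) *\<^sub>R (2 *\<^sub>R (\<Sum>i<k. F i z *\<^sub>R G i z))"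
        by (intro GDERIV_DERIV_compose[OF q] DERIV_real_sqrt sq)
      then have "GDERIV \<phi> z :> (inverse (\<phi> z) / 2) *\<^sub>R (2 *\<^sub>R (\<Sum>i<k. F i z *\<^sub>R G i z))"
        unfolding \<phi>_def[abs_def] L2_set_def .
      moreover have "(inverse (\<phi> z) / 2) *\<^sub>R (2 *\<^sub>R (\<Sum>i<k. F i z *\<^sub>R G i z)) = g"
      proof -
        have "(inverse (\<phi> z) / 2) *\<^sub>R (2 *\<^sub>R v) = inverse (\<phi> z) *\<^sub>R v" for v :: 'a by simp
        moreover have "inverse (\<phi> z) *\<^sub>R (\<Sum>i<k. F i z *\<^sub>R G i z) = g"
          by (simp add: g_def scaleR_sum_right divide_inverse_commute)
        ultimately show ?thesis by metis
      qed
      ultimately have "GDERIV \<phi> z :> g" by (rule GDERIV_subst)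
      moreover have "\<forall>\<^sub>F w in at z. \<phi> z \<le> \<phi> w + c / 2 * norm (w - z)"
      proof -
        have "\<forall>\<^sub>F w in at z. w \<in> ball x s"
          using zs by (intro eventually_at_in_open') auto
        then show ?thesis
        proof eventually_elim
          case (elim w)
          then have "\<phi> z + c / 2 * norm (z - y) \<le> \<phi> w + c / 2 * norm (w - y)"
            using z(2)[of w] by (simp add: \<psi>_def)
          also have "c / 2 * norm (w - y) \<le> c / 2 * (norm (w - z) + norm (z - y))"
            using c norm_triangle_ineq[of "w - z" "z - y"] by (intro mult_left_mono) auto
          finally show ?case by (simp add: algebra_simps)
        qed
      qed
      ultimately have "norm g \<le> c / 2"
        using c by (intro norm_gradient_le_of_perturbed_minimum) auto
      moreover have "c * (\<Sum>i<k. \<bar>F i z / \<phi> z\<bar>) \<le> norm g"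
        unfolding g_def by (rule nondeg[OF zr])
      moreover have "1 \<le> (\<Sum>i<k. \<bar>F i z / \<phi> z\<bar>)"
      proof -
        have "\<phi> z \<le> (\<Sum>i<k. \<bar>F i z\<bar>)"
          unfolding \<phi>_def by (rule L2_set_le_sum_abs)
        then show ?thesis
          using pos by (simp add: le_divide_eq flip: sum_divide_distrib)
      qed
      ultimately show False
        using c by (smt (verit) field_sum_of_halves mult_le_cancel_left1 half_gt_zero)
    qed
    then have "z \<in> X"
      using zero[OF zr] by (auto simp: \<phi>_def L2_set_eq_0_iff)
    moreover have "c / 2 * norm (z - y) \<le> (\<Sum>i<k. \<bar>F i y\<bar>)"
      using zy \<phi>z0 L2_set_le_sum_abs[of "\<lambda>i. F i y" "{..<k}"]
      unfolding \<phi>_def by linarith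
    ultimately show "\<exists>z\<in>X. c / 2 * norm (z - y) \<le> (\<Sum>i<k. \<bar>F i y\<bar>)" by blast
  qed
qed

text \<open>Difference quotients of chords are almost in the kernel, and the projection onto the kernel is continuous.\<close>

lemma tangent_cone_subset_kernel:
  assumes x: "x \<in> X \<inter> ball x0 r"
  shows "tangent_cone X x \<subseteq> kernel x"
proof
  fix t assume "t \<in> tangent_cone X x"
  then obtain h b where hb: "h \<longlonglongrightarrow> (0::real)" "\<And>n. h n > 0" "\<And>n::nat. b n \<in> X"
    "(\<lambda>n. (b n - x) /\<^sub>R h n) \<longlonglongrightarrow> t" and b: "b \<longlonglongrightarrow> x"
    by (rule tangent_cone_memE) blast
  let ?P = "closest_point (kernel x)"
  have bound: "norm (t - ?P t) \<le> 2 * e / c * norm t" if e: "e > 0" for e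
  proof -
    obtain d where d: "d > 0" "ball x d \<subseteq> ball x0 r"
      "\<And>y i. y \<in> ball x d \<Longrightarrow> i < k \<Longrightarrow> norm (G i y - G i x) \<le> e"
      using gradients_close[of x e] x e by blast
    have "\<forall>\<^sub>F n in sequentially. b n \<in> ball x d"
      using b d(1) by (auto simp: tendsto_iff dist_commute)
    then have ev: "\<forall>\<^sub>F n in sequentially. norm ((b n - x) /\<^sub>R h n - ?P ((b n - x) /\<^sub>R h n))
        \<le> 2 * e / c * norm ((b n - x) /\<^sub>R h n)"
    proof eventually_elim
      case (elim n)
      have "norm ((b n - x) - ?P (b n - x)) \<le> 2 * e / c * norm (b n - x)"
        using elim hb(3)[of n] d x e by (intro chord_residual_le[OF _ d(2,3)]) auto
      then have "inverse (h n) * norm ((b n - x) - ?P (b n - x)) \<le> inverse (h n) * (2 * e / c * norm (b n - x))"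
        using hb(2)[of n] by (intro mult_left_mono) (auto intro: less_imp_le)
      moreover have "(b n - x) /\<^sub>R h n - ?P ((b n - x) /\<^sub>R h n) = ((b n - x) - ?P (b n - x)) /\<^sub>R h n"
        by (simp only: closest_point_scaleR[OF subspace_kernel] scaleR_diff_right[of _ "b n - x"])
      moreover have "norm (w /\<^sub>R h n) = inverse (h n) * norm w" for w :: 'a
        using hb(2)[of n] by simp
      ultimately show ?case
        by (simp only: mult.left_commute)
    qed
    have contP: "isCont ?P t"
      using subspace_kernel[of x] by (intro continuous_at_closest_point)
        (auto simp: subspace_imp_convex closed_subspace dest: subspace_0)
    then have "(\<lambda>n. norm ((b n - x) /\<^sub>R h n - ?P ((b n - x) /\<^sub>R h n))) \<longlonglongrightarrow> norm (t - ?P t)"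
      using hb(4) by (intro tendsto_intros isCont_tendsto_compose[OF contP])
    moreover have "(\<lambda>n. 2 * e / c * norm ((b n - x) /\<^sub>R h n)) \<longlonglongrightarrow> 2 * e / c * norm t"
      using hb(4) by (intro tendsto_intros)
    ultimately show ?thesis
      using ev by (intro tendsto_le[OF sequentially_bot])
  qed
  have "norm (t - ?P t) \<le> 0"
  proof -
    have "\<forall>\<^sub>F e in at_right 0. norm (t - ?P t) \<le> 2 * e / c * norm t"
      using bound by (simp add: eventually_at_filter)
    moreover have "((\<lambda>e. 2 * e / c * norm t) \<longlongrightarrow> 0) (at_right 0)"
      using c by (auto intro!: tendsto_eq_intros)
    ultimately show ?thesis
      by (intro tendsto_lowerbound[of "\<lambda>e. 2 * e / c * norm t" 0 "at_right (0::real)"]) simp_all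
  qed
  then show "t \<in> kernel x"
    using closest_point_mem[OF subspace_kernel, of x t] by simp
qed

text \<open>For \<open>t\<close> in the kernel the constraints are violated at \<open>x + h t\<close> only to order \<open>o(h)\<close>, so by
the error bound there is a point of \<open>X\<close> within \<open>o(h)\<close> of \<open>x + h t\<close>.\<close>

lemma kernel_subset_tangent_cone:
  assumes x: "x \<in> X \<inter> ball x0 r"
  shows "kernel x \<subseteq> tangent_cone X x"
proof
  fix t assume t: "t \<in> kernel x"
  obtain \<rho> where \<rho>: "\<rho> > 0" "\<And>y. y \<in> ball x \<rho> \<Longrightarrow> \<exists>z\<in>X. c / 2 * norm (z - y) \<le> (\<Sum>i<k. \<bar>F i y\<bar>)"
    using level_set_error_bound[OF x] by metis
  \<comment> \<open>This scale keeps \<open>x + h n t\<close> in the ball where the error bound holds.\<close>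
  define s where "s = \<rho> / (norm t + 1)"
  define h where "h n = s / real (Suc n)" for n
  have s: "s > 0" using \<rho>(1) by (simp add: s_def add_nonneg_pos)
  have h: "h n > 0" for n using s by (simp add: h_def)
  have h0: "h \<longlonglongrightarrow> 0"
    unfolding h_def divide_inverse
    using tendsto_mult_right_zero[OF LIMSEQ_inverse_real_of_nat] .
  have "x + h n *\<^sub>R t \<in> ball x \<rho>" for n
  proof -
    have "h n * norm t \<le> s * norm t"
      using s by (intro mult_right_mono) (auto simp: h_def divide_le_eq)
    also have "\<dots> < s * (norm t + 1)" using s by simp
    also have "\<dots> = \<rho>" by (simp add: s_def add_nonneg_eq_0_iff)
    finally show ?thesis using h[of n] by (simp add: dist_norm)
  qed
  then have "\<forall>n. \<exists>z. z \<in> X \<and> c / 2 * norm (z - (x + h n *\<^sub>R t)) \<le> (\<Sum>i<k. \<bar>F i (x + h n *\<^sub>R t)\<bar>)"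
    using \<rho>(2) by blast
  then obtain z where z: "\<And>n. z n \<in> X"
    "\<And>n. c / 2 * norm (z n - (x + h n *\<^sub>R t)) \<le> (\<Sum>i<k. \<bar>F i (x + h n *\<^sub>R t)\<bar>)"
    by metis
  have lim: "(\<lambda>n. F i (x + h n *\<^sub>R t) / h n) \<longlonglongrightarrow> 0" if i: "i < k" for i
  proof -
    have D: "(F i has_derivative (\<lambda>h. h \<bullet> G i x)) (at (x + 0 *\<^sub>R t))"
      using grad[OF _ i] x by (simp add: gderiv_def)
    have "((\<lambda>s. x + s *\<^sub>R t) has_derivative (\<lambda>h. h *\<^sub>R t)) (at 0)"
      by (auto intro!: derivative_eq_intros)
    from has_derivative_compose[OF this D]
    have "((\<lambda>s. F i (x + s *\<^sub>R t)) has_derivative (\<lambda>h. (h *\<^sub>R t) \<bullet> G i x)) (at 0)" .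
    moreover have "(\<lambda>h. (h *\<^sub>R t) \<bullet> G i x) = (*) 0"
      using t i by (simp add: fun_eq_iff kernel_def inner_commute)
    ultimately have "((\<lambda>s. F i (x + s *\<^sub>R t)) has_real_derivative 0) (at 0)"
      by (simp only: has_field_derivative_def)
    then have "((\<lambda>s. F i (x + s *\<^sub>R t) / s) \<longlongrightarrow> 0) (at 0)"
      using x zero[of x] i by (simp add: DERIV_def)
    moreover have "filterlim h (at 0) sequentially"
      using h0 h by (simp add: filterlim_at less_imp_neq[symmetric])
    ultimately show ?thesis by (rule filterlim_compose)
  qed
  define w where "w n = (z n - (x + h n *\<^sub>R t)) /\<^sub>R h n" for n
  have "w \<longlonglongrightarrow> 0"
  proof (rule Lim_null_comparison)
    show "(\<lambda>n. 2 / c * (\<Sum>i<k. \<bar>F i (x + h n *\<^sub>R t) / h n\<bar>)) \<longlonglongrightarrow> 0"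
      by (intro tendsto_mult_right_zero tendsto_null_sum tendsto_rabs_zero lim) simp
    show "\<forall>\<^sub>F n in sequentially. norm (w n) \<le> 2 / c * (\<Sum>i<k. \<bar>F i (x + h n *\<^sub>R t) / h n\<bar>)"
    proof (intro always_eventually allI)
      fix n
      have "norm (w n) = norm (z n - (x + h n *\<^sub>R t)) / h n"
        using h[of n] by (simp add: w_def divide_inverse mult.commute)
      also have "\<dots> \<le> (2 / c * (\<Sum>i<k. \<bar>F i (x + h n *\<^sub>R t)\<bar>)) / h n"
        using z(2)[of n] c h[of n] by (intro divide_right_mono) (auto simp: field_simps)
      also have "\<dots> = 2 / c * (\<Sum>i<k. \<bar>F i (x + h n *\<^sub>R t) / h n\<bar>)"
        using h[of n] by (simp add: abs_divide flip: sum_divide_distrib)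
      finally show "norm (w n) \<le> 2 / c * (\<Sum>i<k. \<bar>F i (x + h n *\<^sub>R t) / h n\<bar>)" .
    qed
  qed
  then have "(\<lambda>n. w n + t) \<longlonglongrightarrow> 0 + t" by (intro tendsto_intros)
  moreover have "w n + t = (z n - x) /\<^sub>R h n" for n
    using h[of n] by (simp add: w_def algebra_simps)
  ultimately have "(\<lambda>n. (z n - x) /\<^sub>R h n) \<longlonglongrightarrow> t" by simp
  then show "t \<in> tangent_cone X x"
    using x h0 h z(1) by (intro tangent_cone_memI[where h = h and c = z]) auto
qed

lemma tangent_cone_eq_kernel: "x \<in> X \<inter> ball x0 r \<Longrightarrow> tangent_cone X x = kernel x"
  using tangent_cone_subset_kernel kernel_subset_tangent_cone by blast

end

section \<open>Continuously varying tangent spaces\<close>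

text \<open>What the variational argument uses of a manifold: tangent cones that are subspaces, whose
orthogonal projections vary continuously, and chords that are almost tangent near each point,
uniformly in both end points.\<close>

locale c1_tangent_spaces =
  fixes X :: "'a::euclidean_space set" and xb :: 'a and r :: real
  assumes r: "r > 0" and xb: "xb \<in> X"
    and subspace_tangent: "x \<in> X \<inter> ball xb r \<Longrightarrow> subspace (tangent_cone X x)"
    and projections_close: "x \<in> X \<inter> ball xb r \<Longrightarrow> e > 0 \<Longrightarrow> \<exists>d>0. \<forall>y\<in>X \<inter> ball x d. \<forall>v.
        norm (closest_point (tangent_cone X y) v - closest_point (tangent_cone X x) v) \<le> e * norm v"
    and chords_close: "x \<in> X \<inter> ball xb r \<Longrightarrow> e > 0 \<Longrightarrow> \<exists>d>0. \<forall>y\<in>X \<inter> ball x d. \<forall>z\<in>X \<inter> ball x d.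
        norm ((z - y) - closest_point (tangent_cone X y) (z - y)) \<le> e * norm (z - y)"

lemma (in regular_level_set) level_set_c1_tangent_spaces:
  assumes "r > 0" "x0 \<in> X"
  shows "c1_tangent_spaces X x0 r"
proof
  show "subspace (tangent_cone X x)" if "x \<in> X \<inter> ball x0 r" for x
    using tangent_cone_eq_kernel[OF that] subspace_kernel by simp
next
  fix x e assume x: "x \<in> X \<inter> ball x0 r" and e: "(e::real) > 0"
  have "c * e\<^sup>2 / 2 > 0" using c e by simp
  then obtain d where d: "d > 0" "ball x d \<subseteq> ball x0 r"
      "\<And>y i. y \<in> ball x d \<Longrightarrow> i < k \<Longrightarrow> norm (G i y - G i x) \<le> c * e\<^sup>2 / 2"
    using gradients_close[of x "c * e\<^sup>2 / 2"] x by blast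
  have "norm (closest_point (tangent_cone X y) v - closest_point (tangent_cone X x) v) \<le> e * norm v"
    if y: "y \<in> X \<inter> ball x d" for y v
  proof (rule power2_le_imp_le)
    have yr: "y \<in> X \<inter> ball x0 r" using y d by blast
    have "(norm (closest_point (kernel y) v - closest_point (kernel x) v))\<^sup>2
        \<le> 2 * (c * e\<^sup>2 / 2) / c * (norm v)\<^sup>2"
      using x yr y d(3) c by (intro kernel_projections_close) auto
    then show "(norm (closest_point (tangent_cone X y) v - closest_point (tangent_cone X x) v))\<^sup>2
        \<le> (e * norm v)\<^sup>2"
      using c by (simp add: tangent_cone_eq_kernel[OF x] tangent_cone_eq_kernel[OF yr] power_mult_distrib)
  qed (use e in simp)
  then show "\<exists>d>0. \<forall>y\<in>X \<inter> ball x d. \<forall>v.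
        norm (closest_point (tangent_cone X y) v - closest_point (tangent_cone X x) v) \<le> e * norm v"
    using d(1) by blast
next
  fix x e assume x: "x \<in> X \<inter> ball x0 r" and e: "(e::real) > 0"
  have "c * e / 2 > 0" using c e by simp
  then obtain d where d: "d > 0" "ball x d \<subseteq> ball x0 r"
      "\<And>y i. y \<in> ball x d \<Longrightarrow> i < k \<Longrightarrow> norm (G i y - G i x) \<le> c * e / 2"
    using gradients_close[of x "c * e / 2"] x by blast
  have "norm ((z - y) - closest_point (tangent_cone X y) (z - y)) \<le> e * norm (z - y)"
    if yz: "y \<in> X \<inter> ball x d" "z \<in> X \<inter> ball x d" for y z
  proof -
    have yr: "y \<in> X \<inter> ball x0 r" using yz d by blast
    have "norm ((z - y) - closest_point (kernel y) (z - y)) \<le> 2 * (c * e / 2) / c * norm (z - y)"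
      using c e yz by (intro chord_residual_le[OF _ d(2,3)]) auto
    then show ?thesis
      using c by (simp add: tangent_cone_eq_kernel[OF yr])
  qed
  then show "\<exists>d>0. \<forall>y\<in>X \<inter> ball x d. \<forall>z\<in>X \<inter> ball x d.
        norm ((z - y) - closest_point (tangent_cone X y) (z - y)) \<le> e * norm (z - y)"
    using d(1) by blast
qed fact+

text \<open>Half of the coefficient bound at \<open>xb\<close> survives on a ball on which every gradient has moved by at most half of it.\<close>

lemma smooth_manifold_c1_tangent_spaces:
  fixes X :: "'a::euclidean_space set"
  assumes "smooth_manifold_around d X xb"
  obtains r where "c1_tangent_spaces X xb r"
proof -
  define k where "k = DIM('a) - d"
  obtain N F G where xb: "xb \<in> X" and N: "open N" "xb \<in> N"
    and grad: "\<And>i x. i < k \<Longrightarrow> x \<in> N \<Longrightarrow> GDERIV (F i) x :> G i x"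
    and cont: "\<And>i. i < k \<Longrightarrow> continuous_on N (G i)"
    and XN: "X \<inter> N = {x \<in> N. \<forall>i<k. F i x = 0}"
    and dim: "dim ((\<lambda>i. G i xb) ` {..<k}) = k"
    using assms unfolding smooth_manifold_around_def k_def by blast
  obtain b where b: "b > 0" "\<And>l. b * (\<Sum>i<k. \<bar>l i\<bar>) \<le> norm (\<Sum>i<k. l i *\<^sub>R G i xb)"
    using full_rank_coefficient_bound[OF dim] by blast
  have "\<forall>\<^sub>F y in nhds xb. dist (G i y) (G i xb) < b / 2" if "i < k" for i
  proof -
    have "isCont (G i) xb"
      using cont[OF that] N by (simp add: continuous_on_eq_continuous_at)
    then have "(G i \<longlongrightarrow> G i xb) (nhds xb)"
      by (simp add: isCont_def tendsto_at_iff_tendsto_nhds)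
    then show ?thesis
      using b(1) by (intro tendstoD) simp_all
  qed
  then have "\<forall>\<^sub>F y in nhds xb. \<forall>i\<in>{..<k}. dist (G i y) (G i xb) < b / 2"
    by (intro eventually_ball_finite) auto
  moreover have "\<forall>\<^sub>F y in nhds xb. y \<in> N"
    using N by (intro eventually_nhds_in_open) auto
  ultimately have "\<forall>\<^sub>F y in nhds xb. y \<in> N \<and> (\<forall>i<k. dist (G i y) (G i xb) < b / 2)"
    by eventually_elim simp
  then obtain r where r: "r > 0"
    "\<And>y. y \<in> ball xb r \<Longrightarrow> y \<in> N \<and> (\<forall>i<k. dist (G i y) (G i xb) < b / 2)"
    by (auto simp: eventually_nhds_metric dist_commute)
  interpret regular_level_set X F G k xb r "b / 2"
  proof
    fix x and l :: "nat \<Rightarrow> real" assume x: "x \<in> ball xb r"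
    have "norm ((\<Sum>i<k. l i *\<^sub>R G i xb) - (\<Sum>i<k. l i *\<^sub>R G i x)) = norm (\<Sum>i<k. l i *\<^sub>R (G i xb - G i x))"
      by (simp add: scaleR_diff_right sum_subtractf)
    also have "\<dots> \<le> (\<Sum>i<k. norm (l i *\<^sub>R (G i xb - G i x)))"
      by (rule norm_sum)
    also have "\<dots> \<le> (\<Sum>i<k. \<bar>l i\<bar> * (b / 2))"
      using r(2)[OF x] unfolding norm_scaleR
      by (intro sum_mono mult_left_mono) (auto simp: dist_norm norm_minus_commute intro: less_imp_le)
    also have "\<dots> = b / 2 * (\<Sum>i<k. \<bar>l i\<bar>)"
      by (simp add: sum_distrib_left mult.commute)
    finally show "b / 2 * (\<Sum>i<k. \<bar>l i\<bar>) \<le> norm (\<Sum>i<k. l i *\<^sub>R G i x)"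
      using b(2)[of l] norm_triangle_sub[of "\<Sum>i<k. l i *\<^sub>R G i xb" "\<Sum>i<k. l i *\<^sub>R G i x"]
      by (simp add: field_simps)
  next
    fix i assume "i < k"
    then show "continuous_on (ball xb r) (G i)"
      using cont r(2) by (meson continuous_on_subset subsetI)
  next
    fix x assume "x \<in> ball xb r"
    then show "x \<in> X \<longleftrightarrow> (\<forall>i<k. F i x = 0)"
      using XN r(2)[of x] by blast
  qed (use b grad r in auto)
  show ?thesis
    using that level_set_c1_tangent_spaces[OF r(1) xb] .
qed

context c1_tangent_spaces
begin

abbreviation P :: "'a \<Rightarrow> 'a \<Rightarrow> 'a" where
  "P x \<equiv> closest_point (tangent_cone X x)"

lemma xb_mem: "xb \<in> X \<inter> ball xb r"
  using r xb by simp

lemma projection_tendsto: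
  assumes x: "x \<in> X \<inter> ball xb r" and y: "\<And>k. y k \<in> X" "y \<longlonglongrightarrow> x" and v: "v \<longlonglongrightarrow> w"
  shows "(\<lambda>k. P (y k) (v k)) \<longlonglongrightarrow> P x w"
proof -
  have sub: "subspace (tangent_cone X x)" by (rule subspace_tangent[OF x])
  have "(\<lambda>k. P (y k) (v k) - P x (v k)) \<longlonglongrightarrow> 0"
  proof (rule tendstoI)
    fix e :: real assume e: "e > 0"
    define e' where "e' = e / (norm w + 1)"
    have e': "e' > 0" using e by (simp add: e'_def add_nonneg_pos)
    obtain d where d: "d > 0" "\<And>y v. y \<in> X \<inter> ball x d \<Longrightarrow> norm (P y v - P x v) \<le> e' * norm v"
      using projections_close[OF x e'] by blast
    have "\<forall>\<^sub>F k in sequentially. dist x (y k) < d"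
      using y(2) d(1) by (simp add: tendsto_iff dist_commute)
    moreover have "\<forall>\<^sub>F k in sequentially. norm (v k) < norm w + 1"
      using tendsto_norm[OF v] by (rule order_tendstoD) simp
    ultimately show "\<forall>\<^sub>F k in sequentially. dist (P (y k) (v k) - P x (v k)) 0 < e"
    proof eventually_elim
      case (elim k)
      have "norm (P (y k) (v k) - P x (v k)) \<le> e' * norm (v k)"
        using d(2) y(1) elim by simp
      also have "\<dots> < e' * (norm w + 1)" using e' elim by simp
      also have "\<dots> = e" by (simp add: e'_def add_nonneg_eq_0_iff)
      finally show ?case by simp
    qed
  qed
  moreover have "(\<lambda>k. P x (v k)) \<longlonglongrightarrow> P x w"
  proof (rule isCont_tendsto_compose[OF _ v])
    show "isCont (P x) w"
      using sub by (intro continuous_at_closest_point)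
        (auto simp: subspace_imp_convex closed_subspace dest: subspace_0)
  qed
  ultimately have "(\<lambda>k. (P (y k) (v k) - P x (v k)) + P x (v k)) \<longlonglongrightarrow> 0 + P x w"
    by (rule tendsto_add)
  then show ?thesis by simp
qed

lemma projection_eq_0_iff:
  assumes x: "x \<in> X \<inter> ball xb r"
  shows "P x v = 0 \<longleftrightarrow> (\<forall>t\<in>tangent_cone X x. v \<bullet> t = 0)"
proof
  assume "P x v = 0"
  then show "\<forall>t\<in>tangent_cone X x. v \<bullet> t = 0"
    using closest_point_residual[OF subspace_tangent[OF x], of _ v] by simp
next
  assume "\<forall>t\<in>tangent_cone X x. v \<bullet> t = 0"
  then show "P x v = 0"
    using subspace_0[OF subspace_tangent[OF x]]
    by (intro closest_point_eq_of_orthogonal subspace_tangent x) auto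
qed

text \<open>Both signs of a tangent vector are tangent, so regular normals are orthogonal to the tangent space. Conversely, the inner product
of an orthogonal vector with a chord sees only the part of the chord orthogonal to the tangent space, which is of order
\<open>o(|y - x|)\<close>.\<close>

lemma regular_normal_cone_manifold:
  assumes x: "x \<in> X \<inter> ball xb r"
  shows "v \<in> regular_normal_cone X x \<longleftrightarrow> P x v = 0"
proof
  assume v: "v \<in> regular_normal_cone X x"
  have "v \<bullet> t = 0" if t: "t \<in> tangent_cone X x" for t
  proof -
    have "- t \<in> tangent_cone X x"
      using t subspace_neg[OF subspace_tangent[OF x]] by blast
    then show ?thesis
      using regular_normal_inner_tangent_le[OF v t] regular_normal_inner_tangent_le[OF v, of "- t"] by simp
  qed
  then show "P x v = 0" using projection_eq_0_iff[OF x] by blast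
next
  assume "P x v = 0"
  then have orth: "v \<bullet> t = 0" if "t \<in> tangent_cone X x" for t
    using projection_eq_0_iff[OF x] that by blast
  show "v \<in> regular_normal_cone X x"
    unfolding regular_normal_cone_iff
  proof (intro conjI allI impI)
    show "x \<in> X" using x by blast
    fix e :: real assume e: "e > 0"
    define e' where "e' = e / (norm v + 1)"
    have e': "e' > 0" using e by (simp add: e'_def add_nonneg_pos)
    have "norm v * e' \<le> (norm v + 1) * e'" using e' by simp
    also have "\<dots> = e" by (simp add: e'_def add_nonneg_eq_0_iff)
    finally have ve: "norm v * e' \<le> e" .
    obtain d where d: "d > 0" "\<And>y. y \<in> X \<inter> ball x d \<Longrightarrow> norm ((y - x) - P x (y - x)) \<le> e' * norm (y - x)"
      using chords_close[OF x e'] x by (metis IntD1 IntI centre_in_ball)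
    have "\<forall>\<^sub>F y in at x within X. y \<in> X \<inter> ball x d"
      unfolding eventually_at using d(1) by (auto simp: dist_commute)
    then show "\<forall>\<^sub>F y in at x within X. v \<bullet> (y - x) \<le> e * norm (y - x)"
    proof eventually_elim
      case (elim y)
      have "v \<bullet> (y - x) = v \<bullet> ((y - x) - P x (y - x))"
        using orth[OF closest_point_mem[OF subspace_tangent[OF x]], of "y - x"]
        by (simp add: inner_diff_right)
      also have "\<dots> \<le> norm v * norm ((y - x) - P x (y - x))"
        by (rule norm_cauchy_schwarz)
      also have "\<dots> \<le> norm v * (e' * norm (y - x))"
        using d(2)[OF elim] by (simp add: mult_left_mono)
      also have "\<dots> \<le> e * norm (y - x)"
        using ve by (simp add: mult_right_mono flip: mult.assoc)
      finally show ?case .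
    qed
  qed
qed

lemma normal_cone_manifold: "v \<in> normal_cone X xb \<longleftrightarrow> P xb v = 0"
proof
  assume "v \<in> normal_cone X xb"
  then obtain y w where yw: "y \<longlonglongrightarrow> xb" "\<And>k::nat. y k \<in> X" "w \<longlonglongrightarrow> v"
        "\<And>k. w k \<in> regular_normal_cone X (y k)"
    using xb by (auto simp: normal_cone_def)
  have "\<forall>\<^sub>F k in sequentially. y k \<in> ball xb r"
    using yw(1) r by (auto simp: tendsto_iff dist_commute)
  then have "\<forall>\<^sub>F k in sequentially. P (y k) (w k) = 0"
    by eventually_elim (use yw regular_normal_cone_manifold in blast)
  then have "(\<lambda>k. P (y k) (w k)) \<longlonglongrightarrow> 0" by (rule tendsto_eventually)
  moreover have "(\<lambda>k. P (y k) (w k)) \<longlonglongrightarrow> P xb v"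
    by (rule projection_tendsto[OF xb_mem yw(2,1,3)])
  ultimately show "P xb v = 0" using LIMSEQ_unique by blast
next
  assume "P xb v = 0"
  then show "v \<in> normal_cone X xb"
    using regular_normal_cone_manifold[OF xb_mem] regular_normal_cone_subset_normal_cone by blast
qed

section \<open>Normals of sets lying over a manifold\<close>

text \<open>The correction \<open>P a - a\<close> is orthogonal to the tangent space, hence a normal of \<open>X\<close> that lifts to
\<open>C\<close>, and regular normals form a convex cone.\<close>

lemma projected_regular_normal:
  fixes q :: "'a \<times> 'b::euclidean_space"
  assumes sub: "fst ` C \<subseteq> X" and q: "fst q \<in> ball xb r" and v: "(a, b) \<in> regular_normal_cone C q"
  shows "(P (fst q) a, b) \<in> regular_normal_cone C q"
proof -
  have qC: "q \<in> C" using v by (simp add: regular_normal_cone_iff)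
  then have x: "fst q \<in> X \<inter> ball xb r" using q sub by blast
  have "P (fst q) a - a \<in> regular_normal_cone X (fst q)"
    unfolding regular_normal_cone_manifold[OF x] projection_eq_0_iff[OF x]
    using closest_point_residual[OF subspace_tangent[OF x], of _ a] by (simp add: inner_diff_left)
  then have "(a, b) + (P (fst q) a - a, 0) \<in> regular_normal_cone C q"
    by (intro regular_normal_cone_add v regular_normal_cone_fst[OF _ qC sub])
  then show ?thesis by simp
qed

text \<open>Approximate by regular normals and use that the projections vary continuously with the base point.\<close>

lemma projected_normal:
  fixes q :: "'a \<times> 'b::euclidean_space"
  assumes sub: "fst ` C \<subseteq> X" and q: "fst q \<in> ball xb r" and v: "(a, b) \<in> normal_cone C q"
  shows "(P (fst q) a, b) \<in> normal_cone C q"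
proof -
  have qC: "q \<in> C" using v by (simp add: normal_cone_iff)
  then have x: "fst q \<in> X \<inter> ball xb r" using q sub by blast
  obtain y w where yw: "y \<longlonglongrightarrow> q" "\<And>k::nat. y k \<in> C" "w \<longlonglongrightarrow> (a, b)"
        "\<And>k. w k \<in> regular_normal_cone C (y k)"
    using v qC by (auto simp: normal_cone_def)
  have fy: "(\<lambda>k. fst (y k)) \<longlonglongrightarrow> fst q" using yw(1) by (rule tendsto_fst)
  have yX: "fst (y k) \<in> X" for k using yw(2) sub by blast
  have fw: "(\<lambda>k. fst (w k)) \<longlonglongrightarrow> a" using tendsto_fst[OF yw(3)] by simp
  have sw: "(\<lambda>k. snd (w k)) \<longlonglongrightarrow> b" using tendsto_snd[OF yw(3)] by simp
  have lim: "(\<lambda>k. (P (fst (y k)) (fst (w k)), snd (w k))) \<longlonglongrightarrow> (P (fst q) a, b)"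
    by (intro tendsto_Pair projection_tendsto[OF x yX fy] fw sw)
  have "\<forall>\<^sub>F k in sequentially. fst (y k) \<in> ball xb r"
    using q by (intro topological_tendstoD[OF fy]) auto
  then have "\<forall>\<^sub>F k in sequentially. (P (fst (y k)) (fst (w k)), snd (w k)) \<in> normal_cone C (y k)"
  proof eventually_elim
    case (elim k)
    have "(P (fst (y k)) (fst (w k)), snd (w k)) \<in> regular_normal_cone C (y k)"
      using yw(4)[of k] by (intro projected_regular_normal[OF sub elim]) simp
    then show ?case using regular_normal_cone_subset_normal_cone by blast
  qed
  from normal_cone_closed_graph[OF qC yw(1) lim this] show ?thesis .
qed

text \<open>A strict bound on the tangential limiting normals at the reference point spreads to regular
normals at nearby points. Otherwise there are normals violating it at points converging to
the reference point; projected and scaled to have a unit tangential part, they have a convergent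
subsequence, whose limit is a limiting normal with unit tangential first component and second
component of norm at most \<open>1 / \<kappa>\<close>.\<close>

lemma regular_normals_bound:
  fixes ub :: "'b::euclidean_space"
  assumes sub: "fst ` C \<subseteq> X" and p: "(xb, ub) \<in> C" and \<kappa>: "\<kappa> > 0"
    and bound: "\<And>v w. (v, w) \<in> normal_cone C (xb, ub) \<Longrightarrow> v \<in> tangent_cone X xb \<Longrightarrow> v \<noteq> 0 \<Longrightarrow>
      norm v < \<kappa> * norm w"
  obtains d where "d > 0" "\<And>q v w. q \<in> ball (xb, ub) d \<Longrightarrow> (v, w) \<in> regular_normal_cone C q \<Longrightarrow>
      norm (P (fst q) v) \<le> \<kappa> * norm w"
proof (rule ccontr)
  assume contra: "\<not> thesis"
  have "\<exists>q v w. dist q (xb, ub) < min r (inverse (real (Suc n))) \<and> (v, w) \<in> regular_normal_cone C q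
      \<and> \<kappa> * norm w < norm (P (fst q) v)" for n
  proof (rule ccontr)
    assume "\<not> ?thesis"
    then have "norm (P (fst q) v) \<le> \<kappa> * norm w"
      if "q \<in> ball (xb, ub) (min r (inverse (real (Suc n))))" "(v, w) \<in> regular_normal_cone C q"
      for q v w
      using that unfolding mem_ball dist_commute[of "(xb, ub)"] by (meson not_less)
    then have thesis
      using r by (intro that[of "min r (inverse (real (Suc n)))"]) simp_all
    with contra show False ..
  qed
  then obtain q v w where q: "\<And>n. dist (q n) (xb, ub) < min r (inverse (real (Suc n)))"
    and vw: "\<And>n. (v n, w n) \<in> regular_normal_cone C (q n)"
    and big: "\<And>n. \<kappa> * norm (w n) < norm (P (fst (q n)) (v n))"
    by metis
  have qC: "q n \<in> C" for n using vw[of n] by (simp add: regular_normal_cone_iff)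
  have qX: "fst (q n) \<in> X \<inter> ball xb r" for n
    using qC[of n] sub q[of n] dist_fst_le[of "(xb, ub)" "q n"] by (auto simp: dist_commute)
  have q_lim: "q \<longlonglongrightarrow> (xb, ub)"
    by (rule metric_tendsto_imp_tendsto[OF LIMSEQ_inverse_real_of_nat])
      (intro always_eventually allI, use q in \<open>simp add: less_imp_le\<close>)
  define s where "s n = norm (P (fst (q n)) (v n))" for n
  have s: "s n > 0" for n
    using big[of n] \<kappa> by (simp add: s_def) (metis le_less_trans mult_nonneg_nonneg norm_ge_zero less_imp_le zero_less_norm_iff)
  define a where "a n = P (fst (q n)) (v n) /\<^sub>R s n" for n
  define b where "b n = w n /\<^sub>R s n" for n
  have na: "norm (a n) = 1" for n using s[of n] by (simp add: a_def) (simp add: s_def)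
  have nb: "norm (b n) \<le> 1 / \<kappa>" for n
  proof -
    have "norm (w n) * \<kappa> \<le> s n" using big[of n] by (simp add: s_def mult.commute)
    then show ?thesis using s[of n] \<kappa> by (simp add: b_def field_simps)
  qed
  have aT: "P (fst (q n)) (a n) = a n" for n
    unfolding a_def using subspace_tangent[OF qX[of n]]
    by (intro closest_point_self subspace_scale closest_point_mem)
  have ab: "(a n, b n) \<in> normal_cone C (q n)" for n
  proof -
    have "(P (fst (q n)) (v n), w n) \<in> regular_normal_cone C (q n)"
      using projected_regular_normal[OF sub _ vw] qX by blast
    then have "inverse (s n) *\<^sub>R (P (fst (q n)) (v n), w n) \<in> regular_normal_cone C (q n)"
      using s[of n] by (intro regular_normal_cone_scaleR) (auto intro: less_imp_le)
    then show ?thesis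
      using regular_normal_cone_subset_normal_cone by (auto simp: a_def b_def)
  qed
  have "bounded (range (\<lambda>n. (a n, b n)))"
  proof (rule boundedI)
    fix z assume "z \<in> range (\<lambda>n. (a n, b n))"
    then obtain n where "z = (a n, b n)" by blast
    then show "norm z \<le> 1 + 1 / \<kappa>"
      using norm_Pair_le[of "a n" "b n"] na[of n] nb[of n] by simp
  qed
  then obtain l \<sigma> where l: "strict_mono (\<sigma> :: nat \<Rightarrow> nat)" "((\<lambda>n. (a n, b n)) \<circ> \<sigma>) \<longlonglongrightarrow> l"
    using bounded_imp_convergent_subsequence by blast
  obtain a' b' where l': "l = (a', b')" by fastforce
  have lim: "(\<lambda>n. (a (\<sigma> n), b (\<sigma> n))) \<longlonglongrightarrow> (a', b')"
    using l(2) by (simp add: l' comp_def)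
  have la: "(\<lambda>n. a (\<sigma> n)) \<longlonglongrightarrow> a'" and lb: "(\<lambda>n. b (\<sigma> n)) \<longlonglongrightarrow> b'"
    using tendsto_fst[OF lim] tendsto_snd[OF lim] by simp_all
  have lq: "(\<lambda>n. q (\<sigma> n)) \<longlonglongrightarrow> (xb, ub)"
    using LIMSEQ_subseq_LIMSEQ[OF q_lim l(1)] by (simp add: comp_def)
  have "(a', b') \<in> normal_cone C (xb, ub)"
    using normal_cone_closed_graph[OF p lq lim] ab by simp
  moreover have "a' \<in> tangent_cone X xb"
  proof -
    have "(\<lambda>n. P (fst (q (\<sigma> n))) (a (\<sigma> n))) \<longlonglongrightarrow> P xb a'"
      using qX tendsto_fst[OF lq] by (intro projection_tendsto[OF xb_mem _ _ la]) auto
    then have "P xb a' = a'"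
      using la LIMSEQ_unique unfolding aT by blast
    then show ?thesis
      using closest_point_mem[OF subspace_tangent[OF xb_mem], of a'] by simp
  qed
  moreover have na': "norm a' = 1"
    using tendsto_norm[OF la] by (simp add: na LIMSEQ_const_iff)
  ultimately have "norm a' < \<kappa> * norm b'"
    by (intro bound) auto
  moreover have "norm b' \<le> 1 / \<kappa>"
    using tendsto_norm[OF lb] nb by (intro LIMSEQ_le_const2[OF tendsto_norm[OF lb]]) auto
  ultimately show False
    using na' \<kappa> by (simp add: field_simps)
qed

end

section \<open>Bounds on normals and the Lipschitz inclusion\<close>

text \<open>A point is at distance at most \<open>t\<close> from \<open>s\<close> exactly if it is \<open>s + t b\<close> with \<open>|b|
\<le> 1\<close>.\<close>

lemma lipschitz_inclusion_iff:
  assumes "0 \<le> \<kappa>"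
  shows "lipschitz_inclusion X S V W \<kappa> \<longleftrightarrow>
    (\<forall>x\<in>X \<inter> V. \<forall>x'\<in>X \<inter> V. \<forall>u\<in>S x' \<inter> W. \<exists>s\<in>S x. norm (u - s) \<le> \<kappa> * norm (x' - x))"
proof -
  have "u \<in> {s + t *\<^sub>R b | s b. s \<in> A \<and> b \<in> cball 0 1} \<longleftrightarrow> (\<exists>s\<in>A. norm (u - s) \<le> t)"
    if t: "0 \<le> t" for u :: 'b and t A
  proof
    assume "u \<in> {s + t *\<^sub>R b | s b. s \<in> A \<and> b \<in> cball 0 1}"
    then obtain s b where "u = s + t *\<^sub>R b" "s \<in> A" "norm b \<le> 1" by auto
    then show "\<exists>s\<in>A. norm (u - s) \<le> t"
      using t by (intro bexI[of _ s]) (auto simp: mult_left_le)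
  next
    assume "\<exists>s\<in>A. norm (u - s) \<le> t"
    then obtain s where s: "s \<in> A" "norm (u - s) \<le> t" by blast
    show "u \<in> {s + t *\<^sub>R b | s b. s \<in> A \<and> b \<in> cball 0 1}"
    proof (cases "t = 0")
      case True
      then show ?thesis using s by (auto intro!: exI[of _ s] exI[of _ 0])
    next
      case False
      have "u = s + t *\<^sub>R ((u - s) /\<^sub>R t)" using False by simp
      moreover have "(u - s) /\<^sub>R t \<in> cball 0 1"
        using s t False by (simp add: divide_inverse_commute[symmetric])
      ultimately show ?thesis using s by blast
    qed
  qed
  then show ?thesis
    using assms unfolding lipschitz_inclusion_def subset_iff Ball_def by simp
qed

context c1_tangent_spaces
begin

text \<open>The penalised distance to \<open>x\<^sub>1\<close> is minimised over the graph; a minimiser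
that is not over \<open>x\<^sub>1\<close> contradicts the bound on normals. The parameter \<open>\<epsilon>\<close> makes the penalty
differentiable also at \<open>u = u\<^sub>0\<close>. Its cost \<open>\<epsilon> / \<kappa>'\<close> is absorbed by the gap between \<open>\<kappa>'\<close> and \<open>\<kappa>\<close>.\<close>

lemma lipschitz_inclusion_of_normals_bound:
  fixes S :: "'a \<Rightarrow> 'b::euclidean_space set"
  assumes loc: "locally_closed_at (gph (restr S X)) (xb, ub)"
    and d: "d > 0" "\<And>q v w. q \<in> ball (xb, ub) d \<Longrightarrow> (v, w) \<in> regular_normal_cone (gph (restr S X)) q \<Longrightarrow>
      norm (P (fst q) v) \<le> \<kappa>\<^sub>1 * norm w"
    and \<kappa>\<^sub>1: "0 < \<kappa>\<^sub>1" "\<kappa>\<^sub>1 < \<kappa>"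
  shows "\<exists>V W. xb \<in> interior V \<and> ub \<in> interior W \<and> lipschitz_inclusion X S V W \<kappa>"
proof -
  define C where "C = gph (restr S X)"
  have C_iff: "(x, u) \<in> C \<longleftrightarrow> x \<in> X \<and> u \<in> S x" for x u
    by (auto simp: C_def gph_def restr_def)
  define \<kappa>' where "\<kappa>' = (\<kappa>\<^sub>1 + \<kappa>) / 2"
  have \<kappa>': "\<kappa>\<^sub>1 < \<kappa>'" "\<kappa>' < \<kappa>" "0 < \<kappa>'" "0 < \<kappa>" using \<kappa>\<^sub>1 by (auto simp: \<kappa>'_def)
  \<comment> \<open>With this tolerance for chords, tangential parts of unit chords have norm above \<open>\<kappa>\<^sub>1 / \<kappa>'\<close>.\<close>
  define \<eta> where "\<eta> = (1 - \<kappa>\<^sub>1 / \<kappa>') / 2"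
  have \<eta>: "0 < \<eta>" "\<kappa>\<^sub>1 / \<kappa>' < 1 - \<eta>" using \<kappa>' by (auto simp: \<eta>_def field_simps)
  obtain d' where d': "d' > 0" "\<And>y z. y \<in> X \<inter> ball xb d' \<Longrightarrow> z \<in> X \<inter> ball xb d' \<Longrightarrow>
      norm ((z - y) - P y (z - y)) \<le> \<eta> * norm (z - y)"
    using chords_close[OF xb_mem \<eta>(1)] by blast
  obtain U where U: "closed (C \<inter> U)" "(xb, ub) \<in> interior U"
    using loc unfolding locally_closed_at_def C_def by blast
  then obtain d'' where d'': "d'' > 0" "cball (xb, ub) d'' \<subseteq> U"
    using mem_interior_cball by blast
  define \<rho> where "\<rho> = min (min d d') (min d'' r)"
  have \<rho>: "0 < \<rho>" "\<rho> \<le> d" "\<rho> \<le> d'" "\<rho> \<le> d''" "\<rho> \<le> r"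
    using d d' d'' r by (auto simp: \<rho>_def)
  \<comment> \<open>Chosen so that points with penalised distance at most the initial value stay inside the ball of radius \<open>\<rho>\<close> (see \<open>near\<close> below); then the minimiser is interior.\<close>
  define M where "M = 3 + 2 * \<kappa> + 2 * \<kappa> / \<kappa>'"
  have M: "M \<ge> 3" using \<kappa>' by (simp add: M_def)
  define \<sigma> where "\<sigma> = \<rho> / M"
  have \<sigma>: "\<sigma> > 0" "\<sigma> * M = \<rho>" using \<rho> M by (auto simp: \<sigma>_def)
  have compact: "compact (C \<inter> cball (xb, ub) \<rho>)"
  proof -
    have "C \<inter> cball (xb, ub) \<rho> = (C \<inter> U) \<inter> cball (xb, ub) \<rho>"
      using d'' \<rho>(4) by (auto simp: mem_cball)
    then show ?thesis using U(1) by (simp add: closed_Int_compact)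
  qed
  have main: "\<exists>u\<in>S x\<^sub>1. norm (u\<^sub>0 - u) \<le> \<kappa> * norm (x\<^sub>0 - x\<^sub>1)"
    if x1: "x\<^sub>1 \<in> X \<inter> ball xb \<sigma>" and x0: "x\<^sub>0 \<in> X \<inter> ball xb \<sigma>" and u0: "u\<^sub>0 \<in> S x\<^sub>0 \<inter> ball ub \<sigma>" for x\<^sub>1 x\<^sub>0 u\<^sub>0
  proof (cases "x\<^sub>0 = x\<^sub>1")
    case True
    then show ?thesis using u0 by auto
  next
    case False
    define D where "D = norm (x\<^sub>0 - x\<^sub>1)"
    have D: "D > 0" "D \<le> 2 * \<sigma>"
      using False x0 x1 dist_triangle_less_add[of x\<^sub>0 xb \<sigma> x\<^sub>1 \<sigma>]
      by (auto simp: D_def dist_norm norm_minus_commute)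
    \<comment> \<open>The largest smoothing for which the initial value is still \<open>\<kappa> / \<kappa>' * D\<close>.\<close>
    define \<epsilon> where "\<epsilon> = (\<kappa> - \<kappa>') * D"
    have \<epsilon>: "\<epsilon> > 0" using D \<kappa>' by (simp add: \<epsilon>_def)
    define f where "f z = norm (fst z - x\<^sub>1) + 1 / \<kappa>' * norm (snd z - u\<^sub>0, \<epsilon>)" for z :: "'a \<times> 'b"
    have near: "z \<in> ball (xb, ub) \<rho>" if z: "norm (fst z - x\<^sub>1) + 1 / \<kappa>' * norm (snd z - u\<^sub>0) \<le> \<kappa> / \<kappa>' * D" for z
    proof -
      have le: "\<kappa> / \<kappa>' * D \<le> \<kappa> / \<kappa>' * (2 * \<sigma>)"
        using D \<kappa>' by (intro mult_left_mono) auto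
      have "0 \<le> 1 / \<kappa>' * norm (snd z - u\<^sub>0)" using \<kappa>' by simp
      then have 1: "norm (fst z - x\<^sub>1) \<le> \<sigma> * (2 * \<kappa> / \<kappa>')"
        using z le by (simp add: mult_ac)
      have "1 / \<kappa>' * norm (snd z - u\<^sub>0) \<le> \<kappa> / \<kappa>' * (2 * \<sigma>)"
        using z le norm_ge_zero[of "fst z - x\<^sub>1"] by linarith
      then have 2: "norm (snd z - u\<^sub>0) \<le> \<sigma> * (2 * \<kappa>)"
        using \<kappa>' by (simp add: field_simps)
      have "dist (xb, ub) z \<le> dist xb (fst z) + dist ub (snd z)"
        using norm_Pair_le[of "xb - fst z" "ub - snd z"] by (cases z) (simp add: dist_norm)
      also have "\<dots> \<le> (dist xb x\<^sub>1 + dist x\<^sub>1 (fst z)) + (dist ub u\<^sub>0 + dist u\<^sub>0 (snd z))"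
        by (intro add_mono dist_triangle)
      also have "\<dots> < (\<sigma> + \<sigma> * (2 * \<kappa> / \<kappa>')) + (\<sigma> + \<sigma> * (2 * \<kappa>))"
        using x1 u0 1 2 by (intro add_less_le_mono add_strict_mono) (auto simp: dist_norm norm_minus_commute)
      also have "\<dots> \<le> \<sigma> * M"
        using \<sigma>(1) by (simp add: M_def algebra_simps)
      finally show ?thesis using \<sigma>(2) by simp
    qed
    have "continuous_on (C \<inter> cball (xb, ub) \<rho>) f"
      unfolding f_def by (intro continuous_intros)
    moreover have start: "(x\<^sub>0, u\<^sub>0) \<in> C \<inter> cball (xb, ub) \<rho>"
    proof -
      have "1 \<le> \<kappa> / \<kappa>'" using \<kappa>' by simp
      then have "(x\<^sub>0, u\<^sub>0) \<in> ball (xb, ub) \<rho>"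
        using D(1) mult_right_mono[of 1 "\<kappa> / \<kappa>'" D] by (intro near) (simp add: D_def[symmetric])
      then show ?thesis using x0 u0 by (auto simp: C_iff)
    qed
    ultimately obtain z where z: "z \<in> C \<inter> cball (xb, ub) \<rho>" "\<And>y. y \<in> C \<inter> cball (xb, ub) \<rho> \<Longrightarrow> f z \<le> f y"
      using continuous_attains_inf[OF compact, of f] by blast
    have "f z \<le> f (x\<^sub>0, u\<^sub>0)" using z(2) start by blast
    also have "\<dots> = \<kappa> / \<kappa>' * D"
      using \<epsilon> \<kappa>' by (simp add: f_def D_def[symmetric] norm_Pair \<epsilon>_def field_simps)
    finally have fz: "f z \<le> \<kappa> / \<kappa>' * D" .
    have zle: "norm (fst z - x\<^sub>1) + 1 / \<kappa>' * norm (snd z - u\<^sub>0) \<le> \<kappa> / \<kappa>' * D"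
    proof -
      have "1 / \<kappa>' * norm (snd z - u\<^sub>0) \<le> 1 / \<kappa>' * norm (snd z - u\<^sub>0, \<epsilon>)"
        using \<kappa>' norm_fst_le[of "snd z - u\<^sub>0" \<epsilon>] by (intro mult_left_mono) auto
      then show ?thesis using fz by (simp add: f_def)
    qed
    have z_near: "z \<in> ball (xb, ub) \<rho>" by (rule near[OF zle])
    have zX: "fst z \<in> X" "snd z \<in> S (fst z)"
      using z(1) C_iff[of "fst z" "snd z"] by auto
    have fz_near: "dist xb (fst z) < \<rho>"
      using z_near dist_fst_le[of "(xb, ub)" z] by simp
    have "fst z = x\<^sub>1"
    proof (rule ccontr)
      assume ne: "fst z \<noteq> x\<^sub>1"
      define g where "g = (sgn (fst z - x\<^sub>1), (1 / \<kappa>') *\<^sub>R fst (sgn (snd z - u\<^sub>0, \<epsilon>)))"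
      have D1: "((\<lambda>z. fst z - x\<^sub>1) has_derivative fst) (at z)"
        and D2: "((\<lambda>z. (snd z - u\<^sub>0, \<epsilon>)) has_derivative (\<lambda>h. (snd h, 0))) (at z)"
        by (auto intro!: derivative_eq_intros)
      have "((\<lambda>z. norm (fst z - x\<^sub>1)) has_derivative (\<lambda>h. fst h \<bullet> sgn (fst z - x\<^sub>1))) (at z)"
        by (rule has_derivative_compose[OF D1 has_derivative_norm]) (use ne in simp)
      moreover have "((\<lambda>z. norm (snd z - u\<^sub>0, \<epsilon>)) has_derivative
          (\<lambda>h. (snd h, 0) \<bullet> sgn (snd z - u\<^sub>0, \<epsilon>))) (at z)"
        by (rule has_derivative_compose[OF D2 has_derivative_norm]) (use \<epsilon> in \<open>simp add: zero_prod_def\<close>)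
      ultimately have "(f has_derivative (\<lambda>h. fst h \<bullet> sgn (fst z - x\<^sub>1)
          + 1 / \<kappa>' * ((snd h, 0) \<bullet> sgn (snd z - u\<^sub>0, \<epsilon>)))) (at z)"
        unfolding f_def[abs_def] by (intro has_derivative_add has_derivative_mult_right)
      then have "(f has_derivative (\<lambda>h. h \<bullet> g)) (at z within C)"
        by (simp add: g_def inner_prod_def has_derivative_at_withinI)
      moreover have "\<forall>\<^sub>F y in at z within C. f z \<le> f y"
      proof -
        have "\<forall>\<^sub>F y in at z within C. y \<in> C \<inter> ball (xb, ub) \<rho>"
        proof -
          have "\<forall>\<^sub>F y in nhds z. y \<in> ball (xb, ub) \<rho>"
            using z_near by (intro eventually_nhds_in_open) auto
          then show ?thesis
            unfolding eventually_at_filter by eventually_elim simp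
        qed
        then show ?thesis
          by eventually_elim (use z(2) in auto)
      qed
      ultimately have "- g \<in> regular_normal_cone C z"
        using z(1) by (intro regular_normal_cone_of_minimum) auto
      then have "norm (P (fst z) (- sgn (fst z - x\<^sub>1))) \<le> \<kappa>\<^sub>1 * norm (- ((1 / \<kappa>') *\<^sub>R fst (sgn (snd z - u\<^sub>0, \<epsilon>))))"
        using z_near \<rho>(2) by (intro d(2)) (auto simp: g_def C_def)
      also have "\<dots> \<le> \<kappa>\<^sub>1 * (1 / \<kappa>')"
      proof -
        have "norm (fst (sgn (snd z - u\<^sub>0, \<epsilon>))) \<le> norm (sgn (snd z - u\<^sub>0, \<epsilon>))"
          by (metis norm_fst_le prod.collapse)
        also have "\<dots> \<le> 1" by (simp add: norm_sgn)
        finally have "norm (- ((1 / \<kappa>') *\<^sub>R fst (sgn (snd z - u\<^sub>0, \<epsilon>)))) \<le> 1 / \<kappa>'"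
          using \<kappa>' by (simp add: divide_right_mono)
        then show ?thesis using \<kappa>\<^sub>1 by (intro mult_left_mono) auto
      qed
      also have "\<kappa>\<^sub>1 * (1 / \<kappa>') < 1 - \<eta>" using \<eta> by simp
      finally have small: "norm (P (fst z) (- sgn (fst z - x\<^sub>1))) < 1 - \<eta>" .
      have zr: "fst z \<in> X \<inter> ball xb r" using zX fz_near \<rho> by simp
      let ?v = "x\<^sub>1 - fst z"
      have "\<sigma> \<le> \<sigma> * M" using \<sigma>(1) M by simp
      then have "norm (?v - P (fst z) ?v) \<le> \<eta> * norm ?v"
        using zX fz_near \<rho> x1 \<sigma>(2) by (intro d'(2)) auto
      then have "norm ?v \<le> norm (P (fst z) ?v) + \<eta> * norm ?v"
        using norm_triangle_sub[of ?v "P (fst z) ?v"] by linarith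
      moreover have "P (fst z) (- sgn (fst z - x\<^sub>1)) = P (fst z) ?v /\<^sub>R norm ?v"
      proof -
        have "- sgn (fst z - x\<^sub>1) = ?v /\<^sub>R norm ?v"
          by (simp add: sgn_div_norm norm_minus_commute flip: scaleR_minus_right)
        then show ?thesis
          by (simp add: closest_point_scaleR[OF subspace_tangent[OF zr]])
      qed
      ultimately have "1 - \<eta> \<le> norm (P (fst z) (- sgn (fst z - x\<^sub>1)))"
        using ne by (simp add: field_simps)
      with small show False by simp
    qed
    moreover have "norm (u\<^sub>0 - snd z) \<le> \<kappa> * D"
    proof -
      have "1 / \<kappa>' * norm (snd z - u\<^sub>0) \<le> \<kappa> / \<kappa>' * D"
        using zle norm_ge_zero[of "fst z - x\<^sub>1"] by linarith
      then show ?thesis using \<kappa>' by (simp add: field_simps norm_minus_commute)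
    qed
    ultimately show ?thesis using zX by (auto simp: D_def)
  qed
  have "lipschitz_inclusion X S (ball xb \<sigma>) (ball ub \<sigma>) \<kappa>"
    unfolding lipschitz_inclusion_iff[OF less_imp_le[OF \<kappa>'(4)]] using main by blast
  then show ?thesis
    using \<sigma>(1) by (intro exI[of _ "ball xb \<sigma>"] exI[of _ "ball ub \<sigma>"]) (simp add: interior_open)
qed

text \<open>Choose points of \<open>X\<close> approaching \<open>x\<close> in the tangent direction \<open>t = P v\<close>. The
inclusion supplies points of the graph above them that move at most \<open>\<kappa>\<close> times as fast, and
testing the normal \<open>(v, w)\<close> with these gives \<open>|t|\<^sup>2 = v \<bullet> t \<le> \<kappa> |w| |t|\<close>.\<close>

lemma regular_normal_bound_of_lipschitz_inclusion:
  fixes S :: "'a \<Rightarrow> 'b::euclidean_space set"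
  assumes \<kappa>: "0 \<le> \<kappa>" and incl: "lipschitz_inclusion X S V W \<kappa>"
    and x: "x \<in> ball xb r" "x \<in> interior V" and u: "u \<in> W"
    and vw: "(v, w) \<in> regular_normal_cone (gph (restr S X)) (x, u)"
  shows "norm (P x v) \<le> \<kappa> * norm w"
proof -
  define C where "C = gph (restr S X)"
  have C_iff: "(x, u) \<in> C \<longleftrightarrow> x \<in> X \<and> u \<in> S x" for x u
    by (auto simp: C_def gph_def restr_def)
  have xu: "x \<in> X" "u \<in> S x"
    using vw C_iff[of x u] by (auto simp: regular_normal_cone_iff C_def)
  have xr: "x \<in> X \<inter> ball xb r" using xu x by blast
  define t where "t = P x v"
  have "t \<in> tangent_cone X x"
    unfolding t_def by (rule closest_point_mem[OF subspace_tangent[OF xr]])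
  then obtain h c where hc: "h \<longlonglongrightarrow> (0::real)" "\<And>n. h n > 0" "\<And>n::nat. c n \<in> X"
    "(\<lambda>n. (c n - x) /\<^sub>R h n) \<longlonglongrightarrow> t" and c: "c \<longlonglongrightarrow> x"
    by (rule tangent_cone_memE) blast
  have bound: "v \<bullet> t \<le> (\<kappa> * norm w + e * (1 + \<kappa>)) * norm t" if e: "e > 0" for e
  proof -
    have "\<forall>\<^sub>F y in at (x, u) within C. (v, w) \<bullet> (y - (x, u)) \<le> e * norm (y - (x, u))"
      using vw e by (simp add: regular_normal_cone_iff C_def)
    then obtain d where d: "d > 0" "\<And>y. y \<in> C \<Longrightarrow> dist y (x, u) < d \<Longrightarrow>
        (v, w) \<bullet> (y - (x, u)) \<le> e * norm (y - (x, u))"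
      unfolding eventually_at by (metis diff_self inner_zero_right mult_zero_right norm_zero order_refl)
    have "(\<lambda>n. (1 + \<kappa>) * norm (c n - x)) \<longlonglongrightarrow> (1 + \<kappa>) * norm (x - x)"
      by (intro tendsto_intros c)
    then have "\<forall>\<^sub>F n in sequentially. (1 + \<kappa>) * norm (c n - x) < d"
      using d(1) by (intro order_tendstoD) auto
    moreover have "\<forall>\<^sub>F n in sequentially. c n \<in> interior V"
      using x(2) by (intro topological_tendstoD[OF c]) auto
    ultimately have "\<forall>\<^sub>F n in sequentially. v \<bullet> ((c n - x) /\<^sub>R h n)
        \<le> (\<kappa> * norm w + e * (1 + \<kappa>)) * norm ((c n - x) /\<^sub>R h n)"
    proof eventually_elim
      case (elim n)
      have "c n \<in> X \<inter> V" "x \<in> X \<inter> V"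
        using elim hc(3) x xu interior_subset by blast+
      then obtain u' where u': "u' \<in> S (c n)" "norm (u - u') \<le> \<kappa> * norm (x - c n)"
        using incl xu u unfolding lipschitz_inclusion_iff[OF \<kappa>] by blast
      have n2: "norm (u' - u) \<le> \<kappa> * norm (c n - x)"
        using u'(2) by (simp add: norm_minus_commute)
      have n1: "norm ((c n, u') - (x, u)) \<le> (1 + \<kappa>) * norm (c n - x)"
        using n2 norm_Pair_le[of "c n - x" "u' - u"] by (simp add: algebra_simps)
      have "(v, w) \<bullet> ((c n, u') - (x, u)) \<le> e * norm ((c n, u') - (x, u))"
        using elim(1) n1 hc(3) u' by (intro d(2)) (auto simp: C_iff dist_norm)
      also have "\<dots> \<le> e * ((1 + \<kappa>) * norm (c n - x))"
        using n1 e by (intro mult_left_mono) auto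
      finally have "v \<bullet> (c n - x) \<le> - (w \<bullet> (u' - u)) + e * (1 + \<kappa>) * norm (c n - x)"
        by (simp add: mult.assoc)
      also have "- (w \<bullet> (u' - u)) \<le> norm w * norm (u' - u)"
        using Cauchy_Schwarz_ineq2[of w "u' - u"] by linarith
      also have "\<dots> \<le> norm w * (\<kappa> * norm (c n - x))"
        using n2 by (intro mult_left_mono) auto
      finally have "v \<bullet> (c n - x) \<le> (\<kappa> * norm w + e * (1 + \<kappa>)) * norm (c n - x)"
        by (simp add: algebra_simps)
      then have "inverse (h n) * (v \<bullet> (c n - x)) \<le> inverse (h n) * ((\<kappa> * norm w + e * (1 + \<kappa>)) * norm (c n - x))"
        using hc(2)[of n] by (intro mult_left_mono) auto
      then show ?case
        using hc(2)[of n] by (simp add: mult.left_commute)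
    qed
    moreover have "(\<lambda>n. v \<bullet> ((c n - x) /\<^sub>R h n)) \<longlonglongrightarrow> v \<bullet> t"
      "(\<lambda>n. (\<kappa> * norm w + e * (1 + \<kappa>)) * norm ((c n - x) /\<^sub>R h n)) \<longlonglongrightarrow> (\<kappa> * norm w + e * (1 + \<kappa>)) * norm t"
      using hc(4) by (intro tendsto_intros; assumption)+
    ultimately show ?thesis
      by (intro tendsto_le[OF sequentially_bot])
  qed
  have "norm t * norm t \<le> (\<kappa> * norm w) * norm t"
  proof -
    have "\<forall>\<^sub>F e in at_right 0. v \<bullet> t \<le> (\<kappa> * norm w + e * (1 + \<kappa>)) * norm t"
      using bound by (simp add: eventually_at_filter)
    moreover have "((\<lambda>e. (\<kappa> * norm w + e * (1 + \<kappa>)) * norm t) \<longlongrightarrow> (\<kappa> * norm w + 0 * (1 + \<kappa>)) * norm t) (at_right 0)"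
      by (intro tendsto_intros)
    ultimately have "v \<bullet> t \<le> (\<kappa> * norm w + 0 * (1 + \<kappa>)) * norm t"
      by (intro tendsto_lowerbound[of _ _ "at_right (0::real)"]) simp_all
    then show ?thesis
      using closest_point_inner_self[OF subspace_tangent[OF xr], of v]
      by (simp add: t_def power2_eq_square)
  qed
  then show ?thesis
    using \<kappa> by (cases "t = 0") (auto simp: t_def[symmetric])
qed

text \<open>The constant \<open>\<kappa>\<close> is the same at all nearby points, so the estimate for regular normals passes to their limits.\<close>

lemma normal_bound_of_lipschitz_inclusion:
  fixes S :: "'a \<Rightarrow> 'b::euclidean_space set"
  assumes \<kappa>: "0 \<le> \<kappa>" and incl: "lipschitz_inclusion X S V W \<kappa>"
    and nbhd: "xb \<in> interior V" "ub \<in> interior W"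
    and vw: "(v, w) \<in> normal_cone (gph (restr S X)) (xb, ub)"
  shows "norm (P xb v) \<le> \<kappa> * norm w"
proof -
  define C where "C = gph (restr S X)"
  have sub: "fst ` C \<subseteq> X" by (auto simp: C_def gph_def restr_def split: if_splits)
  have "(xb, ub) \<in> C" using vw by (simp add: normal_cone_iff C_def)
  then obtain y z where yz: "y \<longlonglongrightarrow> (xb, ub)" "\<And>k::nat. y k \<in> C" "z \<longlonglongrightarrow> (v, w)"
        "\<And>k. z k \<in> regular_normal_cone C (y k)"
    using vw by (auto simp: normal_cone_def C_def)
  have fy: "(\<lambda>k. fst (y k)) \<longlonglongrightarrow> xb" and sy: "(\<lambda>k. snd (y k)) \<longlonglongrightarrow> ub"
    using tendsto_fst[OF yz(1)] tendsto_snd[OF yz(1)] by simp_all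
  have fz: "(\<lambda>k. fst (z k)) \<longlonglongrightarrow> v" and sz: "(\<lambda>k. snd (z k)) \<longlonglongrightarrow> w"
    using tendsto_fst[OF yz(3)] tendsto_snd[OF yz(3)] by simp_all
  have "\<forall>\<^sub>F k in sequentially. fst (y k) \<in> ball xb r \<inter> interior V"
    using r nbhd by (intro topological_tendstoD[OF fy]) auto
  moreover have "\<forall>\<^sub>F k in sequentially. snd (y k) \<in> interior W"
    using nbhd by (intro topological_tendstoD[OF sy]) auto
  ultimately have "\<forall>\<^sub>F k in sequentially. norm (P (fst (y k)) (fst (z k))) \<le> \<kappa> * norm (snd (z k))"
  proof eventually_elim
    case (elim k)
    then have "snd (y k) \<in> W" using interior_subset by blast
    with elim show ?case
      using yz(4)[of k] by (intro regular_normal_bound_of_lipschitz_inclusion[OF \<kappa> incl]) (auto simp: C_def)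
  qed
  moreover have "(\<lambda>k. norm (P (fst (y k)) (fst (z k)))) \<longlonglongrightarrow> norm (P xb v)"
    using yz(2) sub by (intro tendsto_norm projection_tendsto[OF xb_mem _ fy fz]) blast
  moreover have "(\<lambda>k. \<kappa> * norm (snd (z k))) \<longlonglongrightarrow> \<kappa> * norm w"
    by (intro tendsto_intros sz)
  ultimately show ?thesis
    by (intro tendsto_le[OF sequentially_bot])
qed

section \<open>Projected coderivatives\<close>

text \<open>Projecting a coderivative value keeps it a value by \<open>projected_normal\<close>, and a tangent vector is its own projection.\<close>

lemma proj_map_coderivative:
  fixes S :: "'a \<Rightarrow> 'b::euclidean_space set"
  shows "proj_map (tangent_cone X xb) (coderivative (restr S X) xb ub) u =
    coderivative (restr S X) xb ub u \<inter> tangent_cone X xb"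
proof -
  have sub: "fst ` gph (restr S X) \<subseteq> X" by (auto simp: gph_def restr_def split: if_splits)
  have T: "subspace (tangent_cone X xb)" by (rule subspace_tangent[OF xb_mem])
  have "P xb a \<in> coderivative (restr S X) xb ub u \<inter> tangent_cone X xb"
    if "a \<in> coderivative (restr S X) xb ub u" for a
    using projected_normal[OF sub, of "(xb, ub)" a "- u"] that r closest_point_mem[OF T]
    by (simp add: coderivative_def)
  moreover have "t = P xb t" if "t \<in> tangent_cone X xb" for t
    using closest_point_self[OF that] by simp
  ultimately show ?thesis
    unfolding proj_map_def proj_set_def proj_point_subspace[OF T] by blast
qed

text \<open>The coderivative at \<open>0\<close> always contains the normal space of \<open>X\<close>, by lifting normals, and it is
stable under projection onto the tangent space. So it exceeds the normal space exactly if it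
contains a nonzero tangent vector.\<close>

lemma coderivative_zero_eq_normal_cone_iff:
  fixes S :: "'a \<Rightarrow> 'b::euclidean_space set"
  assumes ub: "ub \<in> S xb"
  shows "coderivative (restr S X) xb ub 0 = normal_cone X xb \<longleftrightarrow>
    coderivative (restr S X) xb ub 0 \<inter> tangent_cone X xb = {0}"
proof -
  define D where "D = coderivative (restr S X) xb ub 0"
  define C where "C = gph (restr S X)"
  have sub: "fst ` C \<subseteq> X" by (auto simp: C_def gph_def restr_def split: if_splits)
  have p: "(xb, ub) \<in> C" using ub xb by (auto simp: C_def gph_def restr_def)
  have D: "v \<in> D \<longleftrightarrow> (v, 0) \<in> normal_cone C (xb, ub)" for v
    by (simp add: D_def C_def coderivative_def)
  have N_D: "normal_cone X xb \<subseteq> D"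
  proof
    fix v assume "v \<in> normal_cone X xb"
    then have "v \<in> regular_normal_cone X (fst (xb, ub))"
      using normal_cone_manifold regular_normal_cone_manifold[OF xb_mem] by simp
    then have "(v, 0) \<in> regular_normal_cone C (xb, ub)"
      by (rule regular_normal_cone_fst[OF _ p sub])
    then show "v \<in> D" using regular_normal_cone_subset_normal_cone D by blast
  qed
  have T: "subspace (tangent_cone X xb)" by (rule subspace_tangent[OF xb_mem])
  have "D = normal_cone X xb \<longleftrightarrow> D \<inter> tangent_cone X xb = {0}"
  proof
    assume eq: "D = normal_cone X xb"
    have "v = 0" if "v \<in> D" "v \<in> tangent_cone X xb" for v
      using that closest_point_self[OF that(2)] unfolding eq normal_cone_manifold by simp
    moreover have "0 \<in> D"
      unfolding eq normal_cone_manifold using closest_point_self[OF subspace_0[OF T]] .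
    ultimately show "D \<inter> tangent_cone X xb = {0}" using subspace_0[OF T] by blast
  next
    assume triv: "D \<inter> tangent_cone X xb = {0}"
    have "v \<in> normal_cone X xb" if "v \<in> D" for v
    proof -
      have "P xb v \<in> D"
        using projected_normal[OF sub, of "(xb, ub)" v 0] that r by (simp add: D)
      then have "P xb v = 0" using triv closest_point_mem[OF T, of v] by blast
      then show ?thesis by (simp add: normal_cone_manifold)
    qed
    with N_D show "D = normal_cone X xb" by blast
  qed
  then show ?thesis by (simp add: D_def)
qed

text \<open>The constant sequence at the reference point gives one inclusion. For the other, the projected normals at nearby points are
themselves tangential normals there, and both properties pass to the limit.\<close>

lemma proj_coderivative_eq:
  fixes S :: "'a \<Rightarrow> 'b::euclidean_space set"
  assumes ub: "ub \<in> S xb"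
  shows "proj_coderivative X S xb ub u = coderivative (restr S X) xb ub u \<inter> tangent_cone X xb"
proof -
  define C where "C = gph (restr S X)"
  have sub: "fst ` C \<subseteq> X" by (auto simp: C_def gph_def restr_def split: if_splits)
  have p: "(xb, ub) \<in> C" using ub xb by (auto simp: C_def gph_def restr_def)
  have T: "subspace (tangent_cone X xb)" by (rule subspace_tangent[OF xb_mem])
  let ?A = "\<lambda>p. proj_set (tangent_cone X (fst p) \<times> UNIV) (normal_cone C p)"
  have A_subset: "?A q \<subseteq> normal_cone C q \<inter> (tangent_cone X (fst q) \<times> UNIV)"
    if "fst q \<in> X \<inter> ball xb r" for q
  proof
    fix z assume "z \<in> ?A q"
    moreover have sT: "subspace (tangent_cone X (fst q))" by (rule subspace_tangent[OF that])
    moreover have "subspace (tangent_cone X (fst q) \<times> (UNIV :: 'b set))"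
      by (intro subspace_Times sT subspace_UNIV)
    ultimately obtain a b where ab: "(a, b) \<in> normal_cone C q" "z = (P (fst q) a, b)"
      unfolding proj_set_def by (auto simp: proj_point_subspace closest_point_Times_UNIV)
    then show "z \<in> normal_cone C q \<inter> (tangent_cone X (fst q) \<times> UNIV)"
      using projected_normal[OF sub _ ab(1)] that closest_point_mem[OF sT] by auto
  qed
  have mem_A: "(t, b) \<in> ?A (xb, ub)" if "(t, b) \<in> normal_cone C (xb, ub)" "t \<in> tangent_cone X xb" for t b
  proof -
    have "proj_point (tangent_cone X xb \<times> (UNIV :: 'b set)) (t, b) = {(t, b)}"
      by (simp add: proj_point_subspace subspace_Times T subspace_UNIV closest_point_Times_UNIV
          closest_point_self[OF that(2)])
    then show ?thesis
      using that(1) unfolding proj_set_def by force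
  qed
  have "t \<in> proj_coderivative X S xb ub u \<longleftrightarrow>
      (t, - u) \<in> normal_cone C (xb, ub) \<and> t \<in> tangent_cone X xb" for t
  proof
    assume "t \<in> proj_coderivative X S xb ub u"
    then obtain q z where q: "filterlim q (inf (nhds (xb, ub)) (principal C)) sequentially"
      and z: "\<And>k::nat. z k \<in> ?A (q k)" "z \<longlonglongrightarrow> (t, - u)"
      unfolding proj_coderivative_def outer_limit_def C_def by auto
    have q_lim: "q \<longlonglongrightarrow> (xb, ub)" and qC: "\<forall>\<^sub>F k in sequentially. q k \<in> C"
      using q by (auto simp: filterlim_inf filterlim_principal)
    have fq: "(\<lambda>k. fst (q k)) \<longlonglongrightarrow> xb" using tendsto_fst[OF q_lim] by simp
    have "\<forall>\<^sub>F k in sequentially. fst (q k) \<in> ball xb r"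
      using r by (intro topological_tendstoD[OF fq]) auto
    with qC have ev: "\<forall>\<^sub>F k in sequentially. fst (q k) \<in> X \<inter> ball xb r \<and> z k \<in> normal_cone C (q k)
        \<and> fst (z k) \<in> tangent_cone X (fst (q k))"
    proof eventually_elim
      case (elim k)
      then have "fst (q k) \<in> X \<inter> ball xb r" using sub by blast
      then show ?case using A_subset z(1)[of k] by fastforce
    qed
    then obtain K where K: "\<And>k. k \<ge> K \<Longrightarrow> fst (q k) \<in> X \<inter> ball xb r \<and> z k \<in> normal_cone C (q k)
        \<and> fst (z k) \<in> tangent_cone X (fst (q k))"
      by (auto simp: eventually_sequentially)
    have "(t, - u) \<in> normal_cone C (xb, ub)"
      using ev by (intro normal_cone_closed_graph[OF p q_lim z(2)]) (auto elim: eventually_mono)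
    moreover have "t \<in> tangent_cone X xb"
    proof -
      have fz: "(\<lambda>k. fst (z (k + K))) \<longlonglongrightarrow> t"
        using LIMSEQ_ignore_initial_segment[OF tendsto_fst[OF z(2)], of K] by simp
      moreover have "(\<lambda>k. P (fst (q (k + K))) (fst (z (k + K)))) \<longlonglongrightarrow> P xb t"
        using K LIMSEQ_ignore_initial_segment[OF fq, of K]
        by (intro projection_tendsto[OF xb_mem _ _ fz]) auto
      moreover have "P (fst (q (k + K))) (fst (z (k + K))) = fst (z (k + K))" for k
        using K[of "k + K"] by (intro closest_point_self) auto
      ultimately have "P xb t = t" using LIMSEQ_unique by auto
      then show ?thesis using closest_point_mem[OF T, of t] by simp
    qed
    ultimately show "(t, - u) \<in> normal_cone C (xb, ub) \<and> t \<in> tangent_cone X xb" ..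
  next
    assume t: "(t, - u) \<in> normal_cone C (xb, ub) \<and> t \<in> tangent_cone X xb"
    have "filterlim (\<lambda>_::nat. (xb, ub)) (inf (nhds (xb, ub)) (principal C)) sequentially"
      using p by (simp add: filterlim_inf filterlim_principal)
    then have "(t, - u) \<in> outer_limit (inf (nhds (xb, ub)) (principal C)) ?A"
      unfolding outer_limit_def using mem_A t by fastforce
    then show "t \<in> proj_coderivative X S xb ub u"
      by (simp add: proj_coderivative_def C_def)
  qed
  then show ?thesis
    by (auto simp: coderivative_def C_def)
qed

end

section \<open>Outer norms and the equivalences\<close>

text \<open>Scale the normal to \<open>|w| = 1\<close>. If \<open>w = 0\<close>, scaling \<open>v\<close> arbitrarily would make the outer
norm infinite.\<close>

lemma normals_bound_of_outer_norm_less: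
  fixes C :: "('a::euclidean_space \<times> 'b::euclidean_space) set" and H
  assumes T: "subspace T" and H: "\<And>u v. v \<in> H u \<longleftrightarrow> (v, - u) \<in> normal_cone C p \<and> v \<in> T"
    and less: "outer_norm H < ennreal \<kappa>"
    and vw: "(v, w) \<in> normal_cone C p" "v \<in> T" "v \<noteq> 0"
  shows "norm v < \<kappa> * norm w"
proof -
  have small: "norm y < \<kappa>" if "y \<in> H u" "norm u \<le> 1" for u y
  proof -
    have "ennreal (norm y) \<le> outer_norm H"
      unfolding outer_norm_def using that by (intro SUP_upper2[of u] SUP_upper2[of y]) auto
    also note less
    finally show ?thesis by (simp add: ennreal_less_iff)
  qed
  have cone: "s *\<^sub>R v \<in> H (- (s *\<^sub>R w))" if "0 \<le> s" for s
    using normal_cone_scaleR[OF vw(1) that] vw(2) T by (simp add: H subspace_scale)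
  have pos: "\<kappa> > 0"
    using small[of 0 0] cone[of 0] by simp
  show ?thesis
  proof (cases "w = 0")
    case True
    have "norm ((\<kappa> / norm v) *\<^sub>R v) < \<kappa>"
      using pos cone[of "\<kappa> / norm v"] True by (intro small[of _ 0]) auto
    then show ?thesis using vw(3) pos by simp
  next
    case False
    have "norm ((1 / norm w) *\<^sub>R v) < \<kappa>"
      using cone[of "1 / norm w"] False by (intro small[of _ "- ((1 / norm w) *\<^sub>R w)"]) auto
    then show ?thesis using False by (simp add: divide_less_eq)
  qed
qed

lemma closed_normal_cone: "closed (normal_cone C p)"
proof (cases "p \<in> C")
  case True
  then show ?thesis
    unfolding closed_sequential_limits
    using normal_cone_closed_graph[OF True tendsto_const] by (auto intro: always_eventually)
qed (simp add: normal_cone_def)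

text \<open>On the compact set of normals \<open>(v, w)\<close> with \<open>v\<close> in \<open>T\<close>, \<open>|v| = 1\<close> and \<open>|w| \<le> 1\<close> the norm of \<open>w\<close> does not
vanish, so it is at least some \<open>m > 0\<close>. A value of \<open>H\<close> on the unit ball with norm above
\<open>max 1 (1 / m)\<close> would, scaled to unit norm, give an element of this set with \<open>|w| < m\<close>.\<close>

lemma outer_norm_finite_of_trivial_kernel:
  fixes C :: "('a::euclidean_space \<times> 'b::euclidean_space) set" and H
  assumes T: "subspace T" and H: "\<And>u v. v \<in> H u \<longleftrightarrow> (v, - u) \<in> normal_cone C p \<and> v \<in> T"
    and triv: "H 0 = {0}"
  shows "outer_norm H < \<infinity>"
proof -
  define K where "K = normal_cone C p \<inter> (T \<times> UNIV) \<inter> (sphere 0 1 \<times> cball 0 1)"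
  have comp: "compact K"
    unfolding K_def using closed_normal_cone closed_subspace[OF T]
    by (intro closed_Int_compact closed_Int closed_Times compact_Times) auto
  have "\<exists>m>0. \<forall>z\<in>K. m \<le> norm (snd z)"
  proof (cases "K = {}")
    case False
    have "continuous_on K (\<lambda>z. norm (snd z))" by (intro continuous_intros)
    then obtain z where z: "z \<in> K" "\<And>y. y \<in> K \<Longrightarrow> norm (snd z) \<le> norm (snd y)"
      using continuous_attains_inf[OF comp False] by blast
    have "snd z \<noteq> 0"
    proof
      assume "snd z = 0"
      then have "fst z \<in> H 0" "norm (fst z) = 1"
        using z(1) by (auto simp: K_def H prod_eq_iff)
      then show False using triv by auto
    qed
    then show ?thesis using z(2) by (intro exI[of _ "norm (snd z)"]) auto
  qed (auto intro: exI[of _ 1])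
  then obtain m where m: "m > 0" "\<And>z. z \<in> K \<Longrightarrow> m \<le> norm (snd z)" by blast
  have "norm v \<le> max 1 (1 / m)" if v: "v \<in> H u" and u: "norm u \<le> 1" for u v
  proof (rule ccontr)
    assume not: "\<not> ?thesis"
    then have big: "norm v > 1" "norm v > 1 / m" by auto
    \<comment> \<open>Scaling \<open>v\<close> to norm \<open>1\<close> makes the norm of \<open>u\<close> smaller than both \<open>1\<close> and \<open>m\<close>.\<close>
    define s where "s = inverse (norm v)"
    have s: "0 < s" "s < 1" "s < m" "s * norm v = 1"
    proof -
      have v0: "v \<noteq> 0" using big by auto
      then have nv: "norm v > 0" by simp
      show "0 < s" "s * norm v = 1" using v0 by (simp_all add: s_def)
      show "s < 1" using big(1) by (simp add: s_def inverse_less_1_iff)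
      have "1 < norm v * m" using big(2) m(1) by (simp add: divide_less_eq)
      then show "s < m" using pos_divide_less_eq[OF nv, of 1 m] by (simp add: s_def divide_inverse mult.commute)
    qed
    have "s *\<^sub>R (v, - u) \<in> normal_cone C p"
      using v s by (intro normal_cone_scaleR) (auto simp: H)
    moreover have su: "norm (s *\<^sub>R u) \<le> s"
      using s u by (simp add: mult_left_le)
    moreover have "s *\<^sub>R v \<in> T" using v T by (simp add: H subspace_scale)
    moreover have "norm (s *\<^sub>R u) \<le> 1" using su s(2) by linarith
    ultimately have "(s *\<^sub>R v, - (s *\<^sub>R u)) \<in> K"
      using s by (simp add: K_def)
    from m(2)[OF this] su s(3) show False by simp
  qed
  then have "outer_norm H \<le> ennreal (max 1 (1 / m))"
    unfolding outer_norm_def by (intro SUP_least) (auto intro: ennreal_leI)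
  then show ?thesis by (rule le_less_trans) simp
qed

lemma locally_closed_at_gph_restr:
  assumes "closed X" "x \<in> X" "locally_closed_at (gph S) (x, u)"
  shows "locally_closed_at (gph (restr S X)) (x, u)"
proof -
  obtain U where U: "closed U" "(x, u) \<in> interior U" "closed (gph S \<inter> U)" "(x, u) \<in> gph S"
    using assms(3) unfolding locally_closed_at_def by blast
  have eq: "gph (restr S X) = gph S \<inter> X \<times> UNIV"
    by (auto simp: gph_def restr_def split: if_splits)
  have "closed ((gph S \<inter> U) \<inter> X \<times> UNIV)"
    by (intro closed_Int[OF U(3)] closed_Times assms(1) closed_UNIV)
  then have "closed (gph (restr S X) \<inter> U)"
    by (simp add: eq Int_ac)
  then show ?thesis
    unfolding locally_closed_at_def using U assms(2) by (auto simp: eq)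
qed

theorem theorem4p3:
  fixes S :: "real ^ 'n \<Rightarrow> (real ^ 'm) set"
    and X :: "(real ^ 'n) set"
    and xb :: "real ^ 'n"
    and ub :: "real ^ 'm"
    and d :: nat
  assumes "closed X"
    and "xb \<in> X"
    and "smooth_manifold_around d X xb"
    and "ub \<in> S xb"
    and "locally_closed_at (gph S) (xb, ub)"
  shows "(lipschitz_like X S xb ub \<longleftrightarrow>
            proj_map (tangent_cone X xb) (coderivative (restr S X) xb ub) 0 = {0})
       \<and> (lipschitz_like X S xb ub \<longleftrightarrow>
            outer_norm (proj_map (tangent_cone X xb) (coderivative (restr S X) xb ub)) < \<infinity>)
       \<and> (lipschitz_like X S xb ub \<longleftrightarrow>
            coderivative (restr S X) xb ub 0 \<inter> tangent_cone X xb = {0})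
       \<and> (lipschitz_like X S xb ub \<longleftrightarrow>
            coderivative (restr S X) xb ub 0 = normal_cone X xb)
       \<and> (lipschitz_like X S xb ub \<longleftrightarrow>
            proj_coderivative X S xb ub 0 = {0})
       \<and> lip_modulus X S xb ub =
            outer_norm (proj_map (tangent_cone X xb) (coderivative (restr S X) xb ub))"
proof -
  obtain r where "c1_tangent_spaces X xb r"
    using smooth_manifold_c1_tangent_spaces[OF assms(3)] .
  then interpret c1_tangent_spaces X xb r .
  define C where "C = gph (restr S X)"
  define T where "T = tangent_cone X xb"
  define H where "H = proj_map T (coderivative (restr S X) xb ub)"
  have sub: "fst ` C \<subseteq> X" by (auto simp: C_def gph_def restr_def split: if_splits)
  have p: "(xb, ub) \<in> C" using assms(2,4) by (auto simp: C_def gph_def restr_def)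
  have T: "subspace T" unfolding T_def by (rule subspace_tangent[OF xb_mem])
  have H_Int: "H u = coderivative (restr S X) xb ub u \<inter> T" for u
    unfolding H_def T_def by (rule proj_map_coderivative)
  have H: "v \<in> H u \<longleftrightarrow> (v, - u) \<in> normal_cone C (xb, ub) \<and> v \<in> T" for u v
    by (simp add: H_Int coderivative_def C_def)

  have norm_le: "outer_norm H \<le> ennreal \<kappa>"
    if \<kappa>: "0 \<le> \<kappa>" and VW: "xb \<in> interior V" "ub \<in> interior W" "lipschitz_inclusion X S V W \<kappa>" for V W \<kappa>
    unfolding outer_norm_def
  proof (intro SUP_least ennreal_leI)
    fix u v assume u: "u \<in> cball (0 :: real ^ 'm) 1" and v: "v \<in> H u"
    have "norm v = norm (P xb v)"
      using v by (simp add: H T_def closest_point_self)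
    also have "\<dots> \<le> \<kappa> * norm (- u)"
      using v by (intro normal_bound_of_lipschitz_inclusion[OF \<kappa> VW(3,1,2)]) (simp add: H C_def)
    also have "\<dots> \<le> \<kappa>" using \<kappa> u by (simp add: mult_left_le)
    finally show "norm v \<le> \<kappa>" .
  qed
  have inclusion: "\<exists>V W. xb \<in> interior V \<and> ub \<in> interior W \<and> lipschitz_inclusion X S V W \<kappa>"
    if less: "outer_norm H < ennreal \<kappa>" for \<kappa>
  proof -
    \<comment> \<open>The bound on nearby normals holds with a slightly smaller constant; the gap pays for the smoothing and the curvature of \<open>X\<close>.\<close>
    obtain y where y: "outer_norm H < y" "y < ennreal \<kappa>" using dense[OF less] by blast
    then obtain \<kappa>\<^sub>1 where \<kappa>\<^sub>1: "y = ennreal \<kappa>\<^sub>1" "0 \<le> \<kappa>\<^sub>1"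
      by (cases y) auto
    have pos: "0 < \<kappa>\<^sub>1" using y(1) \<kappa>\<^sub>1 by (metis ennreal_0 less_eq_real_def not_less_zero)
    have lt: "\<kappa>\<^sub>1 < \<kappa>" using y(2) \<kappa>\<^sub>1 by (simp add: ennreal_less_iff)
    obtain \<delta> where \<delta>: "\<delta> > 0" "\<And>q v w. q \<in> ball (xb, ub) \<delta> \<Longrightarrow>
        (v, w) \<in> regular_normal_cone C q \<Longrightarrow> norm (P (fst q) v) \<le> \<kappa>\<^sub>1 * norm w"
      using regular_normals_bound[OF sub p pos] normals_bound_of_outer_norm_less[OF T H, of \<kappa>\<^sub>1] y(1) \<kappa>\<^sub>1(1)
      unfolding T_def by metis
    show ?thesis
      using locally_closed_at_gph_restr[OF assms(1,2,5)] \<delta> pos lt unfolding C_def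
      by (rule lipschitz_inclusion_of_normals_bound)
  qed
  have modulus: "lip_modulus X S xb ub = outer_norm H"
  proof (rule antisym)
    show "outer_norm H \<le> lip_modulus X S xb ub"
      unfolding lip_modulus_def using norm_le by (intro Inf_greatest) blast
    show "lip_modulus X S xb ub \<le> outer_norm H"
    proof (rule dense_ge)
      fix y assume y: "outer_norm H < y"
      show "lip_modulus X S xb ub \<le> y"
      proof (cases y)
        case (real \<kappa>)
        then show ?thesis
          unfolding lip_modulus_def using inclusion[of \<kappa>] y by (intro Inf_lower) blast
      qed simp
    qed
  qed
  have c: "lipschitz_like X S xb ub \<longleftrightarrow> outer_norm H < \<infinity>"
  proof
    assume "lipschitz_like X S xb ub"
    then obtain V W \<kappa> where "xb \<in> interior V" "ub \<in> interior W" "0 \<le> \<kappa>" "lipschitz_inclusion X S V W \<kappa>"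
      unfolding lipschitz_like_def by blast
    then have "outer_norm H \<le> ennreal \<kappa>" using norm_le by blast
    then show "outer_norm H < \<infinity>" by (rule le_less_trans) simp
  next
    assume "outer_norm H < \<infinity>"
    then obtain y where y: "outer_norm H < y" "y < \<infinity>" using dense by blast
    then obtain \<kappa> where "y = ennreal \<kappa>" "0 \<le> \<kappa>" by (cases y) auto
    then show "lipschitz_like X S xb ub"
      unfolding lipschitz_like_def using inclusion[of \<kappa>] y(1) assms(5) by blast
  qed
  have b: "outer_norm H < \<infinity> \<longleftrightarrow> H 0 = {0}"
  proof
    assume "outer_norm H < \<infinity>"
    then obtain y where y: "outer_norm H < y" "y < \<infinity>" using dense by blast
    then obtain \<kappa> where \<kappa>: "y = ennreal \<kappa>" by (cases y) auto
    have "v = 0" if "v \<in> H 0" for v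
      using normals_bound_of_outer_norm_less[OF T H, of \<kappa> v 0] y(1) \<kappa> that by (auto simp: H)
    moreover have "0 \<in> H 0"
      using zero_mem_regular_normal_cone[OF p] regular_normal_cone_subset_normal_cone subspace_0[OF T]
      by (auto simp: H zero_prod_def)
    ultimately show "H 0 = {0}" by blast
  qed (rule outer_norm_finite_of_trivial_kernel[OF T H])
  show ?thesis
    using b c modulus H_Int[of 0] coderivative_zero_eq_normal_cone_iff[of ub S] proj_coderivative_eq[of ub S 0] assms(4)
    by (simp add: H_def T_def)
qed

end
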